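(* Let $n\ge 2$ and assume that $G$ is a domain of finite Lebesgue measure in $\mathbb{R}^n$ which satisfies the separation property. Let $\delta\in(0,1)$ and $1\le p<n/\delta$ be given. If there exists a constant $C_1>0$ such that the inequality $$\int_G|u(x)-u_G|^{np/(n-\delta p)}\,dx\le C_1\biggl(\int_G\int_{B(x,\mathrm{dist}(x,\partial G))}\frac{|u(x)-u(y)|^p}{|x-y|^{n+\delta p}}\,dy\,dx\biggr)^{n/(n-\delta p)}$$ holds for every $u\in L^\infty(G)$, then $G$ is a John domain.
   Context: A domain is a nonempty open connected set. $\mathrm{dist}(x,\partial G)$ is the distance from $x\in G$ to the boundary of $G$, $B(x,r)$ is the ball of center $x$ and radius $r$, and $u_G=|G|^{-1}\int_G u(x)\,dx$, where $|G|$ is the Lebesgue measure of $G$. Separation property: a proper domain $G$ in $\mathbb{R}^n$ with a fixed point $x_0\in G$ satisfies a separation property if there exists a constant $C_0>0$ such that the following holds: for every $x\in G$ there exists a curve $\gamma$ joining $x$ to $x_0$ in $G$ (starting at $\gamma(0)=x$) so that for each $t$, writing $B:=B(\gamma(t),C_0\,\mathrm{dist}(\gamma(t),\partial G))$, either $\gamma([0,t])\subset B$, or each $y\in\gamma([0,t])\setminus B$ belongs to a different component of $G\setminus\partial B$ than $x_0$. John domain: a bounded domain $G$ in $\mathbb{R}^n$, $n\ge 2$, is a $c$-John domain with constant $c\ge 1$ if there exists a point of $G$, called a John center and denoted $x_0$, such that every point $x\in G$ can be joined to $x_0$ by a rectifiable curve $\gamma:[0,\ell]\to G$, parametrized by its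 arc length, with $\gamma(0)=x$, $\gamma(\ell)=x_0$ and $\mathrm{dist}(\gamma(t),\partial G)\ge t/c$ for every $t\in[0,\ell]$. $G$ is a John domain if it is a $c$-John domain for some $c\ge 1$. *)

theory Defs
  imports "HOL-Analysis.Analysis"
begin

definition is_domain :: "'a::euclidean_space set \<Rightarrow> bool" where
  "is_domain G \<longleftrightarrow> G \<noteq> {} \<and> open G \<and> connected G"

definition bdist :: "'a::euclidean_space set \<Rightarrow> 'a \<Rightarrow> real" where
  "bdist G x = infdist x (frontier G)"

text \<open>
  ``\<open>y\<close> and \<open>x0\<close> belong to different components'' is read as: no component of \<open>G - \<partial>B\<close>
  contains both. A point of \<open>\<partial>B\<close> lies in no component, so the condition holds vacuously when
  \<open>y\<close> or \<open>x0\<close> lies on the sphere. Demanding that \<open>y\<close> itself avoid \<open>\<partial>B\<close> would make the second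
  alternative void for open balls, since a curve leaving \<open>B\<close> meets \<open>\<partial>B\<close>, which is disjoint
  from \<open>B\<close>. Under the present reading, open and closed balls define the same property.
\<close>

definition separation_property :: "'a::euclidean_space set \<Rightarrow> 'a \<Rightarrow> bool" where
  "separation_property G x0 \<longleftrightarrow>
     is_domain G \<and> G \<noteq> UNIV \<and> x0 \<in> G \<and>
     (\<exists>C0>0. \<forall>x\<in>G. \<exists>\<gamma>. path \<gamma> \<and> path_image \<gamma> \<subseteq> G \<and> pathstart \<gamma> = x \<and> pathfinish \<gamma> = x0 \<and>
        (\<forall>t\<in>{0..1}. let B = ball (\<gamma> t) (C0 * bdist G (\<gamma> t)) in
            \<gamma> ` {0..t} \<subseteq> B \<or>
            (\<forall>y \<in> \<gamma> ` {0..t} - B. \<not> (\<exists>T \<in> components (G - frontier B). y \<in> T \<and> x0 \<in> T))))"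

definition curve_length :: "(real \<Rightarrow> 'a::metric_space) \<Rightarrow> real \<Rightarrow> real \<Rightarrow> ennreal" where
  "curve_length \<gamma> a b =
     (SUP (N, s) \<in> {(N :: nat, s :: nat \<Rightarrow> real). s 0 = a \<and> s N = b \<and> mono_on {..N} s}.
        \<Sum>i<N. ennreal (dist (\<gamma> (s i)) (\<gamma> (s (Suc i)))))"

definition rectifiable_curve :: "(real \<Rightarrow> 'a::metric_space) \<Rightarrow> real \<Rightarrow> real \<Rightarrow> bool" where
  "rectifiable_curve \<gamma> a b \<longleftrightarrow> continuous_on {a..b} \<gamma> \<and> curve_length \<gamma> a b < \<infinity>"

definition arclength_parametrized :: "(real \<Rightarrow> 'a::metric_space) \<Rightarrow> real \<Rightarrow> bool" where
  "arclength_parametrized \<gamma> l \<longleftrightarrow> (\<forall>t\<in>{0..l}. curve_length \<gamma> 0 t = ennreal t)"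

definition c_john_domain :: "real \<Rightarrow> 'a::euclidean_space set \<Rightarrow> bool" where
  "c_john_domain c G \<longleftrightarrow>
     is_domain G \<and> bounded G \<and> c \<ge> 1 \<and>
     (\<exists>x0\<in>G. \<forall>x\<in>G. \<exists>l\<ge>0. \<exists>\<gamma>.
        rectifiable_curve \<gamma> 0 l \<and> arclength_parametrized \<gamma> l \<and> \<gamma> ` {0..l} \<subseteq> G \<and>
        \<gamma> 0 = x \<and> \<gamma> l = x0 \<and> (\<forall>t\<in>{0..l}. bdist G (\<gamma> t) \<ge> t / c))"

definition john_domain :: "'a::euclidean_space set \<Rightarrow> bool" where
  "john_domain G \<longleftrightarrow> (\<exists>c. c_john_domain c G)"

definition Linfty :: "'a::euclidean_space set \<Rightarrow> ('a \<Rightarrow> real) set" where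
  "Linfty G = {u. u \<in> borel_measurable (lebesgue_on G) \<and>
                  (\<exists>M. AE x in lebesgue_on G. \<bar>u x\<bar> \<le> M)}"

definition avg :: "'a::euclidean_space set \<Rightarrow> ('a \<Rightarrow> real) \<Rightarrow> real" where
  "avg G u = inverse (measure lebesgue G) * (LINT x|lebesgue_on G. u x)"

text \<open>The diagonal \<open>y = x\<close> contributes \<open>0 / 0 = 0\<close> and is a null set anyway.\<close>

definition fractional_energy ::
    "real \<Rightarrow> real \<Rightarrow> 'a::euclidean_space set \<Rightarrow> ('a \<Rightarrow> real) \<Rightarrow> ennreal" where
  "fractional_energy \<delta> p G u =
     (\<integral>\<^sup>+x. (\<integral>\<^sup>+y. ennreal (\<bar>u x - u y\<bar> powr p / norm (x - y) powr (real DIM('a) + \<delta> * p))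
              \<partial>lebesgue_on (ball x (bdist G x))) \<partial>lebesgue_on G)"

text \<open>Powers of extended nonnegative reals, meant for exponents \<open>r > 0\<close> (so that \<open>\<infinity>\<close> has power \<open>\<infinity>\<close>).\<close>

definition ennreal_powr :: "ennreal \<Rightarrow> real \<Rightarrow> ennreal" where
  "ennreal_powr a r = (if a = \<infinity> then \<infinity> else ennreal (enn2real a powr r))"

end

theory Submission
  imports Defs
begin

text \<open>
  Write \<open>n\<close> for the dimension, \<open>d(x) = dist(x, \<partial>G)\<close> and \<open>\<beta> = n/(n - \<delta>p) > 1\<close>. The inequality is
  tested on functions that live on one piece \<open>T\<close> of \<open>G\<close> lying behind a ball \<open>B(w, r)\<close>: every segment in
  \<open>G\<close> that leaves \<open>T\<close> must touch the closed ball. The test function \<open>u\<close> vanishes off \<open>T\<close> and, on \<open>T\<close>,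
  climbs linearly from 0 to 1 while \<open>|x - w|\<close> grows from \<open>\<rho>\<close> to \<open>\<rho>'\<close>. Since \<open>\<delta> < 1\<close>, a function with
  values in \<open>[0,1]\<close> and Lipschitz constant \<open>1/(\<rho>' - \<rho>)\<close> has energy at most a constant times
  \<open>|S| (\<rho>' - \<rho>)\<^sup>-\<^sup>\<delta>\<^sup>p\<close>, where \<open>S\<close> is a set that contains a member of each pair \<open>(x, y)\<close> with
  \<open>|x - y| < d(x)\<close> and \<open>u(x) \<noteq> u(y)\<close> (\<open>fractional_energy_le\<close>). As \<open>u\<close> is 0 on a fixed ball \<open>B0\<close> around
  \<open>x0\<close> and 1 on \<open>T\<close> beyond \<open>\<rho>'\<close>, no constant can be close to both values, and the inequality gives
  \<open>|T - B(w, \<rho>')| \<le> A (|S| (\<rho>' - \<rho>)\<^sup>-\<^sup>\<delta>\<^sup>p)\<^sup>\<beta>\<close> (\<open>weak_type_inequality\<close>).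

  This estimate is used with two choices of \<open>S\<close>. With \<open>S = T - B(w, \<rho>)\<close>, where \<open>u\<close> is positive, it bounds
  the volume of \<open>T\<close> beyond \<open>\<rho>'\<close> by a power \<open>\<beta> > 1\<close> of the volume beyond \<open>\<rho>\<close>; the iteration of De Giorgi
  and Stampacchia then shows that \<open>T\<close> ends at distance at most a constant times \<open>|T - B(w, \<rho>0)|\<^sup>1\<^sup>/\<^sup>n\<close>
  beyond \<open>\<rho>0\<close> (\<open>cut_off_piece_subset_cball\<close>). In particular \<open>G\<close> is bounded. With \<open>r = C0 d(w)\<close> and \<open>S\<close> a
  ball around \<open>w\<close> of radius comparable to \<open>d(w)\<close>, it bounds that starting volume by a constant times
  \<open>d(w)\<^sup>n\<close>: a long jump from \<open>T\<close> to its complement passes by \<open>B(w, r)\<close>, and its length is below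
  \<open>d(x) \<le> |x - w| + d(w)\<close>, so that it has to end near \<open>w\<close>. Together, \<open>T\<close> lies in a ball
  \<open>B(w, M d(w))\<close> (\<open>cut_off_piece_subset_proportional_cball\<close>).

  The separation property says that the part of the curve \<open>\<gamma>\<close> before \<open>w = \<gamma>(t)\<close> which is outside
  \<open>B(w, C0 d(w))\<close> lies in such pieces, unless the ball comes so close to \<open>x0\<close> that \<open>d(w)\<close> is bounded
  below, where the diameter of \<open>G\<close> serves as a bound. Hence \<open>|\<gamma>(s) - \<gamma>(t)| \<le> M d(\<gamma>(t))\<close> for all \<open>s \<le> t\<close>
  (\<open>separation_diameter_carrots\<close>). The John condition asks for the same with length in place of diameter,
  and for this \<open>\<gamma>\<close> is replaced by a polygon. Its vertices are \<open>z\<^sub>0 = \<gamma>(0)\<close> and \<open>z\<^sub>i\<^sub>+\<^sub>1\<close>, the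
  point where \<open>\<gamma>\<close> leaves the closed ball \<open>B(z\<^sub>i, d(z\<^sub>i)/2)\<close> for the last time. The vertices are separated,
  so that only a bounded number of them fit in a ball of comparable radius; hence \<open>d(z\<^sub>i)\<close> doubles after
  a bounded number of steps, and \<open>\<Sum>\<^sub>j\<^sub><\<^sub>i d(z\<^sub>j) \<le> C d(z\<^sub>i)\<close> (\<open>separated_sequence_sum_bound\<close>),
  which bounds the length of the polygon before \<open>z\<^sub>i\<close>.
\<close>

section \<open>Distance to the boundary\<close>

lemma ball_bdist_subset:
  assumes "x \<in> G" shows "ball x (bdist G x) \<subseteq> G"
proof
  fix y assume y: "y \<in> ball x (bdist G x)"
  show "y \<in> G"
  proof (rule ccontr)
    assume "y \<notin> G"
    then have "closed_segment x y \<inter> frontier G \<noteq> {}"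
      using assms by (intro connected_Int_frontier) auto
    then obtain z where z: "z \<in> closed_segment x y" "z \<in> frontier G" by blast
    have "bdist G x \<le> dist x z" unfolding bdist_def by (rule infdist_le[OF z(2)])
    also have "\<dots> \<le> dist x y" using dist_in_closed_segment[OF z(1)] by (simp add: dist_commute)
    finally show False using y by simp
  qed
qed

lemma bdist_pos:
  assumes "is_domain G" "G \<noteq> UNIV" "x \<in> G" shows "bdist G x > 0"
proof -
  have "frontier G \<noteq> {}" using assms by (auto simp: is_domain_def frontier_eq_empty)
  moreover have "x \<notin> frontier G" using assms by (auto simp: is_domain_def frontier_def interior_open)
  ultimately show ?thesis unfolding bdist_def
    using infdist_pos_not_in_closed[of "frontier G" x] by simp
qed

lemma bdist_triangle: "bdist G x \<le> bdist G y + dist x y"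
  unfolding bdist_def by (rule infdist_triangle)

lemma ball_segment_subset:
  assumes "x \<in> G" "y \<in> ball x (bdist G x)"
  shows "closed_segment x y \<subseteq> G"
proof -
  have "x \<in> ball x (bdist G x)" using assms(2) by (auto intro: le_less_trans[OF zero_le_dist])
  then have "closed_segment x y \<subseteq> ball x (bdist G x)"
    using assms(2) by (intro closed_segment_subset) auto
  with ball_bdist_subset[OF assms(1)] show ?thesis by blast
qed

section \<open>Fractional energy of Lipschitz functions\<close>

text \<open>
  Cut the space into the shells \<open>2\<^sup>k \<le> L|x - y| < 2\<^sup>k\<^sup>+\<^sup>1\<close>, with \<open>k\<close> an integer, and bound the kernel
  on each of them by its largest value there. With \<open>n\<close> the dimension, a shell has volume of order
  \<open>2\<^sup>k\<^sup>n L\<^sup>-\<^sup>n\<close> and so contributes at most a constant times \<open>L\<^sup>a 2\<^sup>-\<^sup>k\<^sup>a\<close> if \<open>k \<ge> 0\<close> and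
  \<open>L\<^sup>a 2\<^sup>k\<^sup>(\<^sup>p\<^sup>-\<^sup>a\<^sup>)\<close> if \<open>k < 0\<close>; the two geometric series converge as \<open>0 < a < p\<close>.
\<close>
lemma truncated_kernel_integral:
  fixes a p :: real
  assumes "0 < a" "a < p"
  obtains K where "K > 0"
    "\<And>L x. L > 0 \<Longrightarrow> (\<integral>\<^sup>+y. ennreal (min 1 (L * dist x y) powr p / dist x y powr (real DIM('a) + a))
        \<partial>(lborel :: 'a::euclidean_space measure)) \<le> ennreal (K * L powr a)"
proof -
  define n where "n = real DIM('a)"
  have n: "n > 0" by (simp add: n_def)
  define \<omega> where "\<omega> = unit_ball_vol n"
  have \<omega>: "\<omega> > 0" using n by (simp add: \<omega>_def)
  define S1 where "S1 = (\<Sum>k. (2 powr (-a)) ^ k)"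
  define S2 where "S2 = (\<Sum>k. (2 powr (-(p - a))) ^ k)"
  have lt1: "2 powr (-a) < 1" "2 powr (-(p - a)) < 1"
    using assms by (simp_all add: powr_less_one)
  have s1: "(\<lambda>k. (2 powr (-a)) ^ k) sums S1" and s2: "(\<lambda>k. (2 powr (-(p-a))) ^ k) sums S2"
    using lt1 unfolding S1_def S2_def by (auto intro!: summable_sums summable_geometric)
  have S: "S1 \<ge> 0" "S2 \<ge> 0" unfolding S1_def S2_def using s1 s2
    by (auto intro!: suminf_nonneg summable_geometric lt1 simp: sums_iff)
  define K where "K = \<omega> * 2 powr n * S1 + \<omega> * 2 powr (n + a) * S2 + 1"
  show thesis
  proof (rule that)
    show "K > 0" unfolding K_def using \<omega> S by (intro add_nonneg_pos add_nonneg_nonneg mult_nonneg_nonneg) auto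
    fix L :: real and x :: 'a
    assume L: "L > 0"
    \<comment> \<open>\<open>A\<close>, \<open>r\<close> are value and radius for the shells \<open>k \<ge> 0\<close>; \<open>B\<close>, \<open>s\<close> for those with index \<open>-k - 1 < 0\<close>.\<close>
    define A where "A k = (2 powr real k / L) powr (-(n + a))" for k :: nat
    define r where "r k = 2 powr (real k + 1) / L" for k :: nat
    define B where "B k = (2 powr (- real k)) powr p * (2 powr (- (real k + 1)) / L) powr (-(n + a))" for k :: nat
    define s where "s k = 2 powr (- real k) / L" for k :: nat
    define f where "f y = min 1 (L * dist x y) powr p / dist x y powr (n + a)" for y :: 'a
    have AB: "A k \<ge> 0" "B k \<ge> 0" "r k > 0" "s k > 0" for k
      using L by (auto simp: A_def B_def r_def s_def)
    have term_le_suminf: "h j \<le> (\<Sum>k. h k)" for h :: "nat \<Rightarrow> ennreal" and j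
      using sum_le_suminf[of h "{j}"] by simp
    have pw: "ennreal (f y) \<le> (\<Sum>k. ennreal (A k) * indicator (ball x (r k)) y)
                         + (\<Sum>k. ennreal (B k) * indicator (ball x (s k)) y)" for y
    proof (cases "y = x")
      case True then show ?thesis by (simp add: f_def)
    next
      case False
      define t where "t = dist x y"
      have t: "t > 0" using False by (simp add: t_def)
      define k where "k = \<lfloor>log 2 (L * t)\<rfloor>"
      have Lt: "L * t > 0" using L t by simp
      have "of_int k \<le> log 2 (L * t)" "log 2 (L * t) < of_int k + 1"
        unfolding k_def by linarith+
      then have k: "2 powr (of_int k) \<le> L * t" "L * t < 2 powr (of_int k + 1)"
        using Lt by (simp_all add: le_log_iff log_less_iff)
      have neg: "1 / t powr (n + a) \<le> (c / L) powr (-(n + a))" if "0 < c" "c \<le> L * t" for c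
      proof -
        have "c / L \<le> t" using that L by (simp add: field_simps)
        then have "t powr (-(n + a)) \<le> (c / L) powr (-(n+a))"
          using that L n assms by (intro powr_mono2') auto
        then show ?thesis by (simp only: powr_minus_divide)
      qed
      show ?thesis
      proof (cases "k \<ge> 0")
        case True
        then obtain j where j: "k = int j" using nonneg_int_cases by blast
        have "f y \<le> 1 / t powr (n + a)"
          unfolding f_def t_def[symmetric] using Lt assms
          by (intro divide_right_mono powr_le1) auto
        also have "\<dots> \<le> A j" unfolding A_def using k j by (intro neg) auto
        finally have "ennreal (f y) \<le> ennreal (A j) * indicator (ball x (r j)) y"
          using k(2) j L by (auto simp: r_def indicator_def t_def field_simps intro: ennreal_leI)
        also have "\<dots> \<le> (\<Sum>k. ennreal (A k) * indicator (ball x (r k)) y)"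
          by (rule term_le_suminf)
        finally show ?thesis by (simp add: add_increasing2)
      next
        case False
        then obtain j where j: "k = - int j - 1"
          by (metis add.commute add_diff_cancel_right' int_ops(4) minus_add_distrib neg_int_cases not_less of_nat_Suc diff_conv_add_uminus Suc_pred of_nat_0_less_iff)
        have kk: "real_of_int k = - (real j + 1)" "real_of_int k + 1 = - real j" using j by auto
        have "f y = min 1 (L * t) powr p * (1 / t powr (n + a))" by (simp add: f_def t_def)
        also have "\<dots> \<le> B j" unfolding B_def using k kk Lt assms
          by (intro mult_mono neg powr_mono2) auto
        finally have "ennreal (f y) \<le> ennreal (B j) * indicator (ball x (s j)) y"
          using k(2) kk L by (auto simp: s_def indicator_def t_def field_simps intro: ennreal_leI)
        also have "\<dots> \<le> (\<Sum>k. ennreal (B k) * indicator (ball x (s k)) y)"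
          by (rule term_le_suminf)
        finally show ?thesis by (simp add: add_increasing)
      qed
    qed
    have ball: "emeasure lborel (ball x R) = ennreal (\<omega> * R powr n)" if "R > 0" for R
      using emeasure_ball[of R x] that by (simp add: \<omega>_def n_def powr_realpow)
    have eA: "A k * (\<omega> * r k powr n) = \<omega> * 2 powr n * L powr a * (2 powr (-a)) ^ k" for k
    proof -
      have "A k * (\<omega> * r k powr n) = \<omega> * ((2 powr real k / L) powr (-(n + a)) * (2 powr (real k + 1) / L) powr n)"
        by (simp add: A_def r_def)
      also have "(2 powr real k / L) powr (-(n + a)) * (2 powr (real k + 1) / L) powr n
         = 2 powr n * L powr a * (2 powr (-a)) powr (real k)"
        using L by (simp add: powr_def exp_add[symmetric] ln_div algebra_simps exp_minus[symmetric])
      finally show ?thesis by (simp add: powr_realpow)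
    qed
    have eB: "B k * (\<omega> * s k powr n) = \<omega> * 2 powr (n + a) * L powr a * (2 powr (-(p-a))) ^ k" for k
    proof -
      have "B k * (\<omega> * s k powr n) = \<omega> * ((2 powr (- real k)) powr p * (2 powr (- (real k + 1)) / L) powr (-(n + a)) * (2 powr (- real k) / L) powr n)"
        by (simp add: B_def s_def)
      also have "(2 powr (- real k)) powr p * (2 powr (- (real k + 1)) / L) powr (-(n + a)) * (2 powr (- real k) / L) powr n
         = 2 powr (n + a) * L powr a * (2 powr (-(p-a))) powr (real k)"
        using L by (simp add: powr_def exp_add[symmetric] ln_div algebra_simps exp_minus[symmetric])
      finally show ?thesis by (simp add: powr_realpow)
    qed
    have "(\<integral>\<^sup>+y. ennreal (f y) \<partial>lborel) \<le> (\<integral>\<^sup>+y. (\<Sum>k. ennreal (A k) * indicator (ball x (r k)) y)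
                         + (\<Sum>k. ennreal (B k) * indicator (ball x (s k)) y) \<partial>lborel)"
      by (intro nn_integral_mono pw)
    also have "\<dots> = (\<Sum>k. ennreal (A k) * emeasure lborel (ball x (r k)))
                  + (\<Sum>k. ennreal (B k) * emeasure lborel (ball x (s k)))"
    proof -
      have m: "(\<lambda>y. ennreal c * indicator (ball x R) y) \<in> borel_measurable lborel" for c R
      proof -
        have [measurable]: "ball x R \<in> sets borel" by simp
        show ?thesis by measurable
      qed
      have ms: "(\<lambda>y. \<Sum>k. ennreal (c k) * indicator (ball x (R k)) y) \<in> borel_measurable lborel" for c R
      proof -
        have [measurable]: "ball x (R k) \<in> sets borel" for k by simp
        show ?thesis by measurable
      qed
      show ?thesis
        by (subst nn_integral_add[OF ms ms], subst (1 2) nn_integral_suminf[OF m])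
          (simp add: nn_integral_cmult_indicator)
    qed
    also have "(\<Sum>k. ennreal (A k) * emeasure lborel (ball x (r k))) = (\<Sum>k. ennreal (\<omega> * 2 powr n * L powr a * (2 powr (-a)) ^ k))"
      using AB \<omega> by (intro suminf_cong) (simp add: ball ennreal_mult''[symmetric] eA)
    also have "\<dots> = ennreal (\<omega> * 2 powr n * L powr a * S1)"
      using \<omega> by (intro suminf_ennreal_eq sums_mult s1) auto
    also have "(\<Sum>k. ennreal (B k) * emeasure lborel (ball x (s k))) = (\<Sum>k. ennreal (\<omega> * 2 powr (n + a) * L powr a * (2 powr (-(p-a))) ^ k))"
      using AB \<omega> by (intro suminf_cong) (simp add: ball ennreal_mult''[symmetric] eB)
    also have "\<dots> = ennreal (\<omega> * 2 powr (n + a) * L powr a * S2)"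
      using \<omega> by (intro suminf_ennreal_eq sums_mult s2) auto
    also have "ennreal (\<omega> * 2 powr n * L powr a * S1) + ennreal (\<omega> * 2 powr (n + a) * L powr a * S2)
       = ennreal (\<omega> * 2 powr n * L powr a * S1 + \<omega> * 2 powr (n + a) * L powr a * S2)"
      using \<omega> S by (intro ennreal_plus[symmetric]) auto
    also have "\<dots> \<le> ennreal (K * L powr a)"
      by (intro ennreal_leI) (simp add: K_def algebra_simps)
    finally show "(\<integral>\<^sup>+y. ennreal (min 1 (L * dist x y) powr p / dist x y powr (real DIM('a) + a)) \<partial>lborel) \<le> ennreal (K * L powr a)"
      unfolding f_def n_def .
  qed
qed

text \<open>
  The integrand is dominated by the truncated kernel and vanishes unless \<open>x\<close> or \<open>y\<close> lies in \<open>S\<close>. The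
  part with \<open>x \<in> S\<close> is integrated over \<open>y\<close> first; for the part with \<open>y \<in> S\<close> Tonelli's theorem and the
  symmetry of the kernel exchange the roles. The kernel is extended from \<open>y \<in> B(x, d(x))\<close>, a region that
  is not symmetric in \<open>x\<close> and \<open>y\<close>, to the whole space before the exchange.
\<close>
lemma fractional_energy_le:
  fixes \<delta> p :: real
  assumes "0 < \<delta>" "\<delta> < 1" "1 \<le> p"
  obtains K where "K > 0"
    "\<And>(G :: 'a::euclidean_space set) S u L. \<lbrakk>open G; open S; L > 0;
        \<And>x y. \<lbrakk>x \<in> G; y \<in> ball x (bdist G x)\<rbrakk> \<Longrightarrow> \<bar>u x - u y\<bar> \<le> min 1 (L * dist x y);
        \<And>x y. \<lbrakk>x \<in> G; y \<in> ball x (bdist G x); u x \<noteq> u y\<rbrakk> \<Longrightarrow> x \<in> S \<or> y \<in> S\<rbrakk>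
       \<Longrightarrow> fractional_energy \<delta> p G u \<le> ennreal (K * L powr (\<delta> * p)) * emeasure lebesgue S"
proof -
  define a where "a = \<delta> * p"
  have a: "0 < a" "a < p" using assms by (auto simp: a_def)
  obtain K where K: "K > 0"
    "\<And>L x. L > 0 \<Longrightarrow> (\<integral>\<^sup>+y. ennreal (min 1 (L * dist x y) powr p / dist x y powr (real DIM('a) + a))
        \<partial>(lborel :: 'a measure)) \<le> ennreal (K * L powr a)"
    using truncated_kernel_integral[OF a] by blast
  show thesis
  proof (rule that)
    show "2 * K > 0" using K by simp
    fix G S :: "'a set" and u :: "'a \<Rightarrow> real" and L :: real
    assume G: "open G" and S: "open S" and L: "L > 0"
      and lip: "\<And>x y. \<lbrakk>x \<in> G; y \<in> ball x (bdist G x)\<rbrakk> \<Longrightarrow> \<bar>u x - u y\<bar> \<le> min 1 (L * dist x y)"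
      and supp: "\<And>x y. \<lbrakk>x \<in> G; y \<in> ball x (bdist G x); u x \<noteq> u y\<rbrakk> \<Longrightarrow> x \<in> S \<or> y \<in> S"
    define k where "k x y = ennreal (min 1 (L * dist x y) powr p / dist x y powr (real DIM('a) + a))"
      for x y :: 'a
    have kc: "k x y = k y x" for x y by (simp add: k_def dist_commute)
    have kint: "(\<integral>\<^sup>+y. k x y \<partial>lborel) \<le> ennreal (K * L powr a)" for x
      unfolding k_def by (rule K(2)[OF L])
    have km: "(\<lambda>(x, y). k x y) \<in> borel_measurable (borel \<Otimes>\<^sub>M borel)"
      unfolding k_def by (simp add: split_beta) measurable
    have km2: "(\<lambda>(x, y). k y x) \<in> borel_measurable (borel \<Otimes>\<^sub>M borel)"
      unfolding k_def by (simp add: split_beta) measurable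
    have km': "k x \<in> borel_measurable borel" for x
      unfolding k_def by measurable
    have Sm[measurable]: "S \<in> sets borel" using S by simp
    have pw: "ennreal (\<bar>u x - u y\<bar> powr p / norm (x - y) powr (real DIM('a) + \<delta> * p))
       \<le> indicator S x * k x y + indicator S y * k x y" if "x \<in> G" "y \<in> ball x (bdist G x)" for x y
    proof (cases "u x = u y")
      case True then show ?thesis using assms by simp
    next
      case False
      have "ennreal (\<bar>u x - u y\<bar> powr p / norm (x - y) powr (real DIM('a) + \<delta> * p)) \<le> k x y"
        unfolding k_def a_def dist_norm using lip[OF that] assms
        by (intro ennreal_leI divide_right_mono powr_mono2) (auto simp: dist_norm)
      also have "\<dots> \<le> indicator S x * k x y + indicator S y * k x y"
        using supp[OF that False] by (auto simp: indicator_def)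
      finally show ?thesis .
    qed
    have "fractional_energy \<delta> p G u \<le> (\<integral>\<^sup>+x. (\<integral>\<^sup>+y. indicator S x * k x y + indicator S y * k x y \<partial>lborel) \<partial>lborel)"
    proof -
      have "(\<integral>\<^sup>+y. ennreal (\<bar>u x - u y\<bar> powr p / norm (x - y) powr (real DIM('a) + \<delta> * p)) \<partial>lebesgue_on (ball x (bdist G x)))
          \<le> (\<integral>\<^sup>+y. indicator S x * k x y + indicator S y * k x y \<partial>lborel)" if "x \<in> G" for x
      proof -
        have "(\<integral>\<^sup>+y. ennreal (\<bar>u x - u y\<bar> powr p / norm (x - y) powr (real DIM('a) + \<delta> * p)) \<partial>lebesgue_on (ball x (bdist G x)))
          = (\<integral>\<^sup>+y. ennreal (\<bar>u x - u y\<bar> powr p / norm (x - y) powr (real DIM('a) + \<delta> * p)) * indicator (ball x (bdist G x)) y \<partial>lebesgue)"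
          by (subst nn_integral_restrict_space) auto
        also have "\<dots> \<le> (\<integral>\<^sup>+y. indicator S x * k x y + indicator S y * k x y \<partial>lebesgue)"
          using pw[OF that] by (intro nn_integral_mono) (auto simp: indicator_def)
        finally show ?thesis by (simp add: nn_integral_completion)
      qed
      then have "fractional_energy \<delta> p G u \<le> (\<integral>\<^sup>+x. (\<integral>\<^sup>+y. indicator S x * k x y + indicator S y * k x y \<partial>lborel) * indicator G x \<partial>lebesgue)"
        unfolding fractional_energy_def using G
        by (subst nn_integral_restrict_space) (auto intro!: nn_integral_mono simp: indicator_def)
      also have "\<dots> \<le> (\<integral>\<^sup>+x. (\<integral>\<^sup>+y. indicator S x * k x y + indicator S y * k x y \<partial>lborel) \<partial>lebesgue)"
        by (intro nn_integral_mono) (auto simp: indicator_def)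
      finally show ?thesis by (simp add: nn_integral_completion)
    qed
    also have "\<dots> = (\<integral>\<^sup>+x. indicator S x * (\<integral>\<^sup>+y. k x y \<partial>lborel) + (\<integral>\<^sup>+y. indicator S y * k x y \<partial>lborel) \<partial>lborel)"
      using km' by (subst nn_integral_add) (auto simp: nn_integral_cmult)
    also have "\<dots> = (\<integral>\<^sup>+x. indicator S x * (\<integral>\<^sup>+y. k x y \<partial>lborel) \<partial>lborel) + (\<integral>\<^sup>+x. (\<integral>\<^sup>+y. indicator S y * k x y \<partial>lborel) \<partial>lborel)"
    proof (rule nn_integral_add)
      show "(\<lambda>x. indicator S x * (\<integral>\<^sup>+y. k x y \<partial>lborel)) \<in> borel_measurable lborel"
        using km by measurable
      show "(\<lambda>x. (\<integral>\<^sup>+y. indicator S y * k x y \<partial>lborel)) \<in> borel_measurable lborel"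
        using km by measurable
    qed
    also have "(\<integral>\<^sup>+x. (\<integral>\<^sup>+y. indicator S y * k x y \<partial>lborel) \<partial>lborel) = (\<integral>\<^sup>+y. (\<integral>\<^sup>+x. indicator S y * k x y \<partial>lborel) \<partial>lborel)"
      using km km2 by (intro lborel_pair.Fubini') (auto simp: split_beta)
    also have "\<dots> = (\<integral>\<^sup>+y. indicator S y * (\<integral>\<^sup>+x. k y x \<partial>lborel) \<partial>lborel)"
      using km' by (simp add: kc[of _ "_::'a"] nn_integral_cmult)
    also have "(\<integral>\<^sup>+x. indicator S x * (\<integral>\<^sup>+y. k x y \<partial>lborel) \<partial>lborel) + (\<integral>\<^sup>+y. indicator S y * (\<integral>\<^sup>+x. k y x \<partial>lborel) \<partial>lborel)
      \<le> (\<integral>\<^sup>+x. ennreal (K * L powr a) * indicator S x \<partial>lborel) + (\<integral>\<^sup>+x. ennreal (K * L powr a) * indicator S x \<partial>lborel)"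
      using kint by (intro add_mono nn_integral_mono) (auto simp: indicator_def)
    also have "\<dots> = (ennreal (K * L powr a) + ennreal (K * L powr a)) * emeasure lborel S"
      by (subst (1 2) nn_integral_cmult_indicator) (simp_all add: distrib_right)
    also have "ennreal (K * L powr a) + ennreal (K * L powr a) = ennreal (2 * K * L powr a)"
      using K(1) by (subst ennreal_plus[symmetric]) auto
    also have "emeasure lborel S = emeasure lebesgue S" by (simp add: emeasure_completion)
    finally show "fractional_energy \<delta> p G u \<le> ennreal (2 * K * L powr (\<delta> * p)) * emeasure lebesgue S"
      by (simp add: a_def)
  qed
qed

section \<open>Pieces of the domain cut off by a ball\<close>

text \<open>
  The condition on segments replaces the statement that \<open>T\<close> is a union of components of \<open>G\<close> minus a sphere
  or a ball around \<open>w\<close>: it is what the estimate of differences of functions supported in \<open>T\<close> uses, and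
  it holds for components and for \<open>G\<close> minus a closed ball alike.
\<close>
definition cut_off_by_cball :: "'a::euclidean_space set \<Rightarrow> 'a set \<Rightarrow> 'a \<Rightarrow> real \<Rightarrow> bool" where
  "cut_off_by_cball G T w r \<longleftrightarrow> open T \<and> T \<subseteq> G \<and>
     (\<forall>x\<in>T. \<forall>y\<in>G - T. closed_segment x y \<subseteq> G \<longrightarrow> (\<exists>z\<in>closed_segment x y. dist z w \<le> r))"

definition ramp :: "'a::euclidean_space set \<Rightarrow> 'a \<Rightarrow> real \<Rightarrow> real \<Rightarrow> 'a \<Rightarrow> real" where
  "ramp T w \<rho> \<rho>' x = (if x \<in> T then max 0 (min 1 ((dist x w - \<rho>) / (\<rho>' - \<rho>))) else 0)"

lemma ramp_range: "0 \<le> ramp T w \<rho> \<rho>' x" "ramp T w \<rho> \<rho>' x \<le> 1"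
  by (auto simp: ramp_def)

lemma ramp_Linfty:
  assumes "open T" "open G"
  shows "ramp T w \<rho> \<rho>' \<in> Linfty G"
proof -
  have [measurable]: "T \<in> sets borel" using assms by simp
  have "ramp T w \<rho> \<rho>' \<in> borel_measurable borel"
    unfolding ramp_def[abs_def] by measurable
  then have "ramp T w \<rho> \<rho>' \<in> borel_measurable lebesgue"
    by (simp add: measurable_completion)
  then have "ramp T w \<rho> \<rho>' \<in> borel_measurable (lebesgue_on G)"
    by (rule measurable_restrict_space1)
  moreover have "AE x in lebesgue_on G. \<bar>ramp T w \<rho> \<rho>' x\<bar> \<le> 1"
    using ramp_range[of T w \<rho> \<rho>'] by (simp add: abs_of_nonneg)
  ultimately show ?thesis unfolding Linfty_def by blast
qed

text \<open>Both bounds come from the triangle inequality at a point where the segment meets the ball.\<close>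
lemma cut_off_crossing:
  assumes "cut_off_by_cball G T w r" "x \<in> T" "y \<notin> T" "y \<in> G" "closed_segment x y \<subseteq> G"
  shows "dist x w + dist y w \<le> dist x y + 2 * r" "dist x w \<le> dist x y + r"
proof -
  obtain z where z: "z \<in> closed_segment x y" "dist z w \<le> r"
    using assms unfolding cut_off_by_cball_def by blast
  have "dist x y = dist x z + dist z y" using z(1) between_mem_segment between by metis
  moreover have "dist x w \<le> dist x z + dist z w" by (rule dist_triangle)
  moreover have "dist y w \<le> dist z y + dist z w" using dist_triangle[of y w z] by (simp add: dist_commute)
  ultimately show "dist x w + dist y w \<le> dist x y + 2 * r" "dist x w \<le> dist x y + r"
    using z(2) zero_le_dist[of z y] by linarith+
qed

text \<open>
  Inside \<open>G\<close>, the set \<open>T\<close> borders on its complement only at points within \<open>r \<le> \<rho>\<close> of \<open>w\<close>. The ramp is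
  0 there, so that its extension by 0 creates no jump. For \<open>y \<in> B(x, d(x))\<close> the segment from \<open>x\<close> to \<open>y\<close> stays in \<open>G\<close>, so it finds such a
  point if just one of its ends is in \<open>T\<close>.
\<close>
lemma ramp_lipschitz:
  assumes cut: "cut_off_by_cball G T w r" and r: "r \<le> \<rho>" "\<rho> < \<rho>'"
    and xy: "x \<in> G" "y \<in> ball x (bdist G x)"
  shows "\<bar>ramp T w \<rho> \<rho>' x - ramp T w \<rho> \<rho>' y\<bar> \<le> min 1 (1 / (\<rho>' - \<rho>) * dist x y)"
proof -
  let ?u = "ramp T w \<rho> \<rho>'"
  have y: "y \<in> G" using ball_bdist_subset xy by blast
  have seg: "closed_segment x y \<subseteq> G" by (rule ball_segment_subset[OF xy])
  have one: "\<bar>?u x - ?u y\<bar> \<le> 1"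
    using ramp_range[of T w \<rho> \<rho>' x] ramp_range[of T w \<rho> \<rho>' y] by linarith
  have cross: "?u a \<le> 1 / (\<rho>' - \<rho>) * dist x y"
    if "a \<in> T" "b \<notin> T" "b \<in> G" "closed_segment a b \<subseteq> G" "dist a b = dist x y" for a b
  proof -
    have "dist a w - \<rho> \<le> dist x y" using cut_off_crossing(2)[OF cut that(1-4)] r that(5) by linarith
    then have "(dist a w - \<rho>) / (\<rho>' - \<rho>) \<le> dist x y / (\<rho>' - \<rho>)"
      using r by (intro divide_right_mono) auto
    then show ?thesis using that(1) r by (simp add: ramp_def min.coboundedI2)
  qed
  have "\<bar>?u x - ?u y\<bar> \<le> 1 / (\<rho>' - \<rho>) * dist x y"
  proof -
    consider "x \<in> T" "y \<in> T" | "x \<in> T" "y \<notin> T" | "x \<notin> T" "y \<in> T" | "x \<notin> T" "y \<notin> T" by blast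
    then show ?thesis
    proof cases
      case 1
      have "\<bar>dist x w - dist y w\<bar> \<le> dist x y" using abs_dist_diff_le[of x w y] by (simp add: dist_commute)
      then have "\<bar>(dist x w - \<rho>) / (\<rho>' - \<rho>) - (dist y w - \<rho>) / (\<rho>' - \<rho>)\<bar> \<le> 1 / (\<rho>' - \<rho>) * dist x y"
        using r by (simp add: diff_divide_distrib[symmetric] divide_right_mono)
      then show ?thesis using 1 by (simp add: ramp_def)
    next
      case 2
      then show ?thesis using cross[of x y] y seg ramp_range[of T w \<rho> \<rho>' x] by (simp add: ramp_def)
    next
      case 3
      then show ?thesis using cross[of y x] xy seg ramp_range[of T w \<rho> \<rho>' y]
        by (simp add: ramp_def dist_commute closed_segment_commute)
    next
      case 4
      then show ?thesis using r by (simp add: ramp_def)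
    qed
  qed
  with one show ?thesis by simp
qed


definition fractional_sobolev_poincare :: "real \<Rightarrow> real \<Rightarrow> real \<Rightarrow> 'a::euclidean_space set \<Rightarrow> bool" where
  "fractional_sobolev_poincare C \<delta> p G \<longleftrightarrow> (\<forall>u\<in>Linfty G.
     (\<integral>\<^sup>+x. ennreal (\<bar>u x - avg G u\<bar> powr (real DIM('a) * p / (real DIM('a) - \<delta> * p)))
        \<partial>lebesgue_on G)
     \<le> ennreal C * ennreal_powr (fractional_energy \<delta> p G u)
                       (real DIM('a) / (real DIM('a) - \<delta> * p)))"

lemma ennreal_powr_le:
  assumes "a \<le> ennreal e" "0 \<le> e" "0 \<le> r"
  shows "ennreal_powr a r \<le> ennreal (e powr r)"
proof -
  have fin: "a \<noteq> \<infinity>" using assms(1) by (auto simp: top_unique)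
  have "enn2real a \<le> e" using assms by (simp add: enn2real_leI)
  then show ?thesis using fin assms
    by (auto simp: ennreal_powr_def intro!: ennreal_leI powr_mono2)
qed

text \<open>
  Whatever the mean value \<open>m\<close> of the ramp is, either \<open>m \<ge> 1/2\<close> and \<open>|u - m| \<ge> 1/2\<close> on \<open>B0\<close>, or
  \<open>m < 1/2\<close> and \<open>|u - m| \<ge> 1/2\<close> on the part \<open>W\<close> of \<open>T\<close> beyond \<open>\<rho>'\<close>. The smaller of \<open>|B0|\<close> and
  \<open>|W|\<close> is therefore controlled by the energy, and it is at least \<open>|W| |B0| / |G|\<close>.
\<close>
lemma weak_type_inequality:
  fixes G B0 :: "'a::euclidean_space set" and \<delta> p :: real
  assumes par: "0 < \<delta>" "\<delta> < 1" "1 \<le> p" "\<delta> * p < real DIM('a)"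
    and SP: "fractional_sobolev_poincare C \<delta> p G" "C > 0"
    and G: "open G" "emeasure lebesgue G < \<infinity>"
    and B0: "open B0" "B0 \<subseteq> G" "B0 \<noteq> {}"
  obtains A where "A > 0"
    "\<And>T w r \<rho> \<rho>' S. \<lbrakk>cut_off_by_cball G T w r; T \<inter> B0 = {}; r \<le> \<rho>; \<rho> < \<rho>'; open S; emeasure lebesgue S < \<infinity>;
        \<And>x y. \<lbrakk>x \<in> G; y \<in> ball x (bdist G x); ramp T w \<rho> \<rho>' x \<noteq> ramp T w \<rho> \<rho>' y\<rbrakk> \<Longrightarrow> x \<in> S \<or> y \<in> S\<rbrakk>
      \<Longrightarrow> measure lebesgue {x\<in>T. \<rho>' < dist x w}
        \<le> A * (measure lebesgue S / (\<rho>' - \<rho>) powr (\<delta> * p)) powr (real DIM('a) / (real DIM('a) - \<delta> * p))"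
proof -
  define \<beta> where "\<beta> = real DIM('a) / (real DIM('a) - \<delta> * p)"
  define q where "q = real DIM('a) * p / (real DIM('a) - \<delta> * p)"
  define g where "g = measure lebesgue G"
  define b where "b = measure lebesgue B0"
  have \<beta>: "\<beta> > 0" using par by (simp add: \<beta>_def)
  have q: "q > 0" using par by (simp add: q_def)
  have lm: "G \<in> lmeasurable" using G by (auto intro!: fmeasurableI)
  have bm: "B0 \<in> lmeasurable" using B0 by (intro fmeasurableI2[OF lm]) auto
  have b: "b > 0"
  proof -
    have "B0 \<notin> null_sets lebesgue" using B0 open_not_negligible[OF B0(1)] 
      by (simp add: negligible_iff_null_sets)
    then have "emeasure lebesgue B0 \<noteq> 0" using B0 by (auto simp: null_sets_def)
    then show ?thesis using bm unfolding b_def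
      by (simp add: emeasure_eq_measure2 zero_less_measure_iff)
  qed
  have bg: "b \<le> g" unfolding b_def g_def using B0 lm bm by (intro measure_mono_fmeasurable) auto
  obtain K where K: "K > 0"
    "\<And>(G :: 'a::euclidean_space set) S u L. \<lbrakk>open G; open S; L > 0;
        \<And>x y. \<lbrakk>x \<in> G; y \<in> ball x (bdist G x)\<rbrakk> \<Longrightarrow> \<bar>u x - u y\<bar> \<le> min 1 (L * dist x y);
        \<And>x y. \<lbrakk>x \<in> G; y \<in> ball x (bdist G x); u x \<noteq> u y\<rbrakk> \<Longrightarrow> x \<in> S \<or> y \<in> S\<rbrakk>
       \<Longrightarrow> fractional_energy \<delta> p G u \<le> ennreal (K * L powr (\<delta> * p)) * emeasure lebesgue S"
    using fractional_energy_le[OF par(1-3)] by blast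
  define A where "A = (g / b) * 2 powr q * C * K powr \<beta>"
  show thesis
  proof (rule that)
    show "A > 0" unfolding A_def using b bg K SP by auto
    fix T S :: "'a set" and w r \<rho> \<rho>'
    assume cut: "cut_off_by_cball G T w r" and TB: "T \<inter> B0 = {}" and r: "r \<le> \<rho>" "\<rho> < \<rho>'"
      and S: "open S" "emeasure lebesgue S < \<infinity>"
      and supp: "\<And>x y. \<lbrakk>x \<in> G; y \<in> ball x (bdist G x); ramp T w \<rho> \<rho>' x \<noteq> ramp T w \<rho> \<rho>' y\<rbrakk> \<Longrightarrow> x \<in> S \<or> y \<in> S"
    have T: "open T" "T \<subseteq> G" using cut by (auto simp: cut_off_by_cball_def)
    define u where "u = ramp T w \<rho> \<rho>'"
    define m where "m = avg G u"
    define s where "s = measure lebesgue S / (\<rho>' - \<rho>) powr (\<delta> * p)"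
    have s: "s \<ge> 0" by (simp add: s_def)
    define W where "W = {x\<in>T. \<rho>' < dist x w}"
    have "open W"
    proof -
      have "W = T \<inter> - cball w \<rho>'" by (auto simp: W_def dist_commute)
      then show ?thesis using T by auto
    qed
    have Wm: "W \<in> lmeasurable" using \<open>open W\<close> T by (intro fmeasurableI2[OF lm]) (auto simp: W_def)
    define V where "V = measure lebesgue W"
    have "W \<subseteq> G" using T by (auto simp: W_def)
    then have V: "0 \<le> V" "V \<le> g" unfolding V_def g_def using lm Wm
      by (auto intro: measure_mono_fmeasurable)
    have "fractional_energy \<delta> p G u \<le> ennreal (K * (1 / (\<rho>' - \<rho>)) powr (\<delta> * p)) * emeasure lebesgue S"
      unfolding u_def using G S r
      by (intro K(2) ramp_lipschitz[OF cut] supp) auto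
    also have "emeasure lebesgue S = ennreal (measure lebesgue S)"
      using S by (intro emeasure_eq_ennreal_measure) auto
    also have "ennreal (K * (1 / (\<rho>' - \<rho>)) powr (\<delta> * p)) * \<dots> = ennreal (K * s)"
      using K(1) r by (subst ennreal_mult''[symmetric]) (auto simp: s_def powr_divide)
    finally have E: "ennreal_powr (fractional_energy \<delta> p G u) \<beta> \<le> ennreal ((K * s) powr \<beta>)"
      using K(1) s \<beta> by (intro ennreal_powr_le) auto
    have uL: "u \<in> Linfty G" unfolding u_def using T G by (intro ramp_Linfty) auto
    have "(\<integral>\<^sup>+x. ennreal (\<bar>u x - m\<bar> powr q) \<partial>lebesgue_on G) \<le> ennreal C * ennreal_powr (fractional_energy \<delta> p G u) \<beta>"
      using SP(1) uL unfolding fractional_sobolev_poincare_def q_def \<beta>_def m_def by blast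
    also have "\<dots> \<le> ennreal C * ennreal ((K * s) powr \<beta>)"
      by (intro mult_left_mono E) auto
    also have "\<dots> = ennreal (C * K powr \<beta> * s powr \<beta>)"
      using K(1) SP(2) s by (simp add: ennreal_mult'' [symmetric] powr_mult)
    finally have up: "(\<integral>\<^sup>+x. ennreal (\<bar>u x - m\<bar> powr q) \<partial>lebesgue_on G) \<le> ennreal (C * K powr \<beta> * s powr \<beta>)" .
    have low: "(1/2) powr q * measure lebesgue X \<le> C * K powr \<beta> * s powr \<beta>"
      if X: "X \<subseteq> G" "X \<in> lmeasurable" "\<And>x. x \<in> X \<Longrightarrow> 1/2 \<le> \<bar>u x - m\<bar>" for X
    proof -
      have "ennreal ((1/2) powr q * measure lebesgue X) = (\<integral>\<^sup>+x. ennreal ((1/2) powr q) * indicator X x \<partial>lebesgue)"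
        using X by (simp add: nn_integral_cmult_indicator fmeasurableD emeasure_eq_measure2 ennreal_mult'')
      also have "\<dots> \<le> (\<integral>\<^sup>+x. ennreal (\<bar>u x - m\<bar> powr q) * indicator G x \<partial>lebesgue)"
        using X q by (intro nn_integral_mono) (auto simp: indicator_def intro!: ennreal_leI powr_mono2)
      also have "\<dots> = (\<integral>\<^sup>+x. ennreal (\<bar>u x - m\<bar> powr q) \<partial>lebesgue_on G)"
        using G by (subst nn_integral_restrict_space) auto
      also note up
      finally show ?thesis using SP K(1) by (subst (asm) ennreal_le_iff) auto
    qed
    have "(1/2) powr q * (V * b / g) \<le> C * K powr \<beta> * s powr \<beta>"
    proof (cases "m \<ge> 1/2")
      case True
      have "(1/2) powr q * (V * b / g) \<le> (1/2) powr q * b"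
        using V b bg by (intro mult_left_mono) (auto simp: field_simps)
      also have "\<dots> \<le> C * K powr \<beta> * s powr \<beta>" unfolding b_def
        using B0 bm TB True by (intro low) (auto simp: u_def ramp_def)
      finally show ?thesis .
    next
      case False
      have "(1/2) powr q * (V * b / g) \<le> (1/2) powr q * V"
        using V b bg by (intro mult_left_mono) (auto simp: field_simps intro: mult_left_mono)
      also have "\<dots> \<le> C * K powr \<beta> * s powr \<beta>" unfolding V_def
        using T Wm False r by (intro low) (auto simp: u_def ramp_def W_def)
      finally show ?thesis .
    qed
    then have "V \<le> A * s powr \<beta>"
      using b bg by (simp add: A_def field_simps powr_divide)
    then show "measure lebesgue {x\<in>T. \<rho>' < dist x w}
        \<le> A * (measure lebesgue S / (\<rho>' - \<rho>) powr (\<delta> * p)) powr (real DIM('a) / (real DIM('a) - \<delta> * p))"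
      by (simp add: V_def W_def s_def \<beta>_def)
  qed
qed

text \<open>
  Evaluate the recursive inequality along the levels \<open>\<rho>\<^sub>k = \<rho>0 + K v (1 - 2\<^sup>-\<^sup>k)\<close>. The gain from the
  exponent \<open>n/(n - \<sigma>) > 1\<close> beats the loss from the shrinking gaps, and \<open>V \<rho>\<^sub>k \<le> (v 2\<^sup>-\<^sup>k)\<^sup>n\<close>
  reproduces itself as soon as \<open>A (2/K)\<^sup>\<alpha> \<le> 2\<^sup>-\<^sup>n\<close> with \<open>\<alpha> = \<sigma>n/(n - \<sigma>)\<close>. The exponent \<open>n\<close> of \<open>v\<close> is
  forced by the homogeneity of the inequality, and it makes \<open>K v\<close> a length.
\<close>
lemma de_giorgi_stampacchia_iteration:
  fixes A \<sigma> n :: real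
  assumes "A > 0" "0 < \<sigma>" "\<sigma> < n"
  obtains K where "K > 0"
    "\<And>V \<rho>0 v. \<lbrakk>v > 0; V \<rho>0 \<le> v powr n; antimono V; \<And>\<rho>. 0 \<le> V \<rho>;
       \<And>\<rho> \<rho>'. \<rho>0 \<le> \<rho> \<Longrightarrow> \<rho> < \<rho>' \<Longrightarrow> V \<rho>' \<le> A * (V \<rho> / (\<rho>' - \<rho>) powr \<sigma>) powr (n / (n - \<sigma>))\<rbrakk>
      \<Longrightarrow> V (\<rho>0 + K * v) = 0"
proof -
  define \<beta> where "\<beta> = n / (n - \<sigma>)"
  define \<alpha> where "\<alpha> = \<sigma> * \<beta>"
  have \<beta>: "\<beta> > 0" "\<alpha> > 0" using assms by (auto simp: \<beta>_def \<alpha>_def)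
  have n\<beta>: "(n - \<sigma>) * \<beta> = n" using assms by (simp add: \<beta>_def)
  define K where "K = 2 * (A * 2 powr n) powr (1 / \<alpha>)"
  have K: "K > 0" unfolding K_def using assms by simp
  have K2: "A * (2 / K) powr \<alpha> = 2 powr (-n)"
  proof -
    have "(2 / K) powr \<alpha> = 1 / (A * 2 powr n)"
      using assms \<beta> by (simp add: K_def powr_divide powr_powr)
    then show ?thesis using assms by (simp add: powr_minus_divide)
  qed
  show thesis
  proof (rule that[OF K])
    fix V :: "real \<Rightarrow> real" and \<rho>0 v :: real
    assume v: "v > 0" and V0: "V \<rho>0 \<le> v powr n" and mono: "antimono V" and pos: "\<And>\<rho>. 0 \<le> V \<rho>"
      and step: "\<And>\<rho> \<rho>'. \<rho>0 \<le> \<rho> \<Longrightarrow> \<rho> < \<rho>' \<Longrightarrow> V \<rho>' \<le> A * (V \<rho> / (\<rho>' - \<rho>) powr \<sigma>) powr (n / (n - \<sigma>))"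
    define \<rho> where "\<rho> k = \<rho>0 + K * v * (1 - 2 powr (- real k))" for k :: nat
    have decay: "V (\<rho> k) \<le> (v * 2 powr (- real k)) powr n" for k
    proof (induction k)
      case 0 then show ?case using V0 by (simp add: \<rho>_def)
    next
      case (Suc k)
      define e where "e = 2 powr (- real k)"
      have e: "0 < e" "e \<le> 1" by (auto simp: e_def powr_minus_divide powr_realpow)
      have "- real (Suc k) = - real k - 1" by simp
      then have e2: "2 powr (- real (Suc k)) = e / 2"
        by (simp only: powr_diff e_def) simp
      have d: "\<rho> (Suc k) - \<rho> k = K * v * e / 2"
        unfolding \<rho>_def e2 e_def[symmetric] by (simp add: algebra_simps)
      have "V (\<rho> (Suc k)) \<le> A * (V (\<rho> k) / (\<rho> (Suc k) - \<rho> k) powr \<sigma>) powr \<beta>"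
        unfolding \<beta>_def
      proof (rule step)
        show "\<rho>0 \<le> \<rho> k" using K v e unfolding \<rho>_def e_def[symmetric] by simp
        show "\<rho> k < \<rho> (Suc k)" using d K v e by (smt (verit) divide_pos_pos mult_pos_pos)
      qed
      also have "\<dots> \<le> A * ((v * e) powr n / (K * v * e / 2) powr \<sigma>) powr \<beta>"
        unfolding d using Suc.IH assms \<beta> pos[of "\<rho> k"] unfolding e_def[symmetric]
        by (intro mult_left_mono powr_mono2 divide_right_mono) auto
      also have "(v * e) powr n / (K * v * e / 2) powr \<sigma> = (v * e) powr (n - \<sigma>) * (2 / K) powr \<sigma>"
        using K v e by (simp add: powr_diff powr_mult powr_divide field_simps)
      also have "\<dots> powr \<beta> = (v * e) powr n * (2 / K) powr \<alpha>"
        using K v e by (simp add: powr_mult powr_powr n\<beta> \<alpha>_def powr_divide)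
      also have "A * ((v * e) powr n * (2 / K) powr \<alpha>) = (v * e) powr n * 2 powr (-n)"
        using K2 by (simp add: ac_simps)
      also have "\<dots> = (v * (e / 2)) powr n"
        using v e by (simp add: powr_mult powr_divide powr_minus_divide)
      finally show ?case unfolding e2 .
    qed
    have le: "V (\<rho>0 + K * v) \<le> (v * 2 powr (- real k)) powr n" for k
    proof -
      have "\<rho> k \<le> \<rho>0 + K * v" using K v unfolding \<rho>_def by simp
      then show ?thesis using decay[of k] antimonoD[OF mono] by (meson order.trans)
    qed
    have "(\<lambda>k. v powr n * (2 powr (-n)) ^ k) \<longlonglongrightarrow> v powr n * 0"
      using assms by (intro tendsto_mult tendsto_const LIMSEQ_power_zero) (simp add: powr_less_one)
    moreover have "(v * 2 powr (- real k)) powr n = v powr n * (2 powr (-n)) ^ k" for k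
      using v by (simp add: powr_mult powr_powr powr_realpow[symmetric] mult.commute)
    ultimately have "V (\<rho>0 + K * v) \<le> 0"
      using le by (intro LIMSEQ_le_const[of _ 0 "V (\<rho>0 + K * v)"]) auto
    then show "V (\<rho>0 + K * v) = 0" using pos[of "\<rho>0 + K * v"] by linarith
  qed
qed

text \<open>
  The ramp between \<open>\<rho>\<close> and \<open>\<rho>'\<close> is zero outside the part of \<open>T\<close> beyond \<open>\<rho>\<close>, so that this part can serve
  as \<open>S\<close>, and the volume of \<open>T\<close> beyond \<open>\<rho>\<close> satisfies the hypothesis of the iteration. Beyond
  \<open>\<rho>0 + K v\<close> there remains an open null set, which is empty.
\<close>
lemma cut_off_piece_subset_cball:
  fixes G B0 :: "'a::euclidean_space set" and \<delta> p :: real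
  assumes par: "0 < \<delta>" "\<delta> < 1" "1 \<le> p" "\<delta> * p < real DIM('a)"
    and SP: "fractional_sobolev_poincare C \<delta> p G" "C > 0"
    and G: "open G" "emeasure lebesgue G < \<infinity>"
    and B0: "open B0" "B0 \<subseteq> G" "B0 \<noteq> {}"
  obtains K where "K > 0"
    "\<And>T w r \<rho>0 v. \<lbrakk>cut_off_by_cball G T w r; T \<inter> B0 = {}; r \<le> \<rho>0; v > 0;
        measure lebesgue {x\<in>T. \<rho>0 < dist x w} \<le> v powr real DIM('a)\<rbrakk>
      \<Longrightarrow> T \<subseteq> cball w (\<rho>0 + K * v)"
proof (rule weak_type_inequality[OF par SP G B0])
  fix A :: real
  assume A: "A > 0"
    "\<And>T w r \<rho> \<rho>' S. \<lbrakk>cut_off_by_cball G T w r; T \<inter> B0 = {}; r \<le> \<rho>; \<rho> < \<rho>'; open S; emeasure lebesgue S < \<infinity>;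
        \<And>x y. \<lbrakk>x \<in> G; y \<in> ball x (bdist G x); ramp T w \<rho> \<rho>' x \<noteq> ramp T w \<rho> \<rho>' y\<rbrakk> \<Longrightarrow> x \<in> S \<or> y \<in> S\<rbrakk>
      \<Longrightarrow> measure lebesgue {x\<in>T. \<rho>' < dist x w}
        \<le> A * (measure lebesgue S / (\<rho>' - \<rho>) powr (\<delta> * p)) powr (real DIM('a) / (real DIM('a) - \<delta> * p))"
  have \<sigma>: "0 < \<delta> * p" using par by simp
  show thesis
  proof (rule de_giorgi_stampacchia_iteration[OF A(1) \<sigma> par(4)])
    fix K :: real
    assume K: "K > 0"
      "\<And>V \<rho>0 v. \<lbrakk>v > 0; V \<rho>0 \<le> v powr real DIM('a); antimono V; \<And>\<rho>. 0 \<le> V \<rho>;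
       \<And>\<rho> \<rho>'. \<rho>0 \<le> \<rho> \<Longrightarrow> \<rho> < \<rho>' \<Longrightarrow> V \<rho>' \<le> A * (V \<rho> / (\<rho>' - \<rho>) powr (\<delta> * p)) powr (real DIM('a) / (real DIM('a) - \<delta> * p))\<rbrakk>
      \<Longrightarrow> V (\<rho>0 + K * v) = 0"
    show thesis
    proof (rule that[OF K(1)])
      fix T :: "'a set" and w r \<rho>0 v
      assume cut: "cut_off_by_cball G T w r" and TB: "T \<inter> B0 = {}" and r: "r \<le> \<rho>0" and v: "v > 0"
        and V0: "measure lebesgue {x\<in>T. \<rho>0 < dist x w} \<le> v powr real DIM('a)"
      have T: "open T" "T \<subseteq> G" using cut by (auto simp: cut_off_by_cball_def)
      define U where "U \<rho> = {x\<in>T. \<rho> < dist x w}" for \<rho>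
      have Uo: "open (U \<rho>)" for \<rho>
      proof -
        have "U \<rho> = T \<inter> - cball w \<rho>" by (auto simp: U_def dist_commute)
        then show ?thesis using T by auto
      qed
      have G': "G \<in> lmeasurable" using G by (auto intro!: fmeasurableI)
      have Um: "U \<rho> \<in> lmeasurable" for \<rho>
        using Uo T by (intro fmeasurableI2[OF G']) (auto simp: U_def)
      have "measure lebesgue (U (\<rho>0 + K * v)) = 0"
      proof (rule K(2)[of v "\<lambda>\<rho>. measure lebesgue (U \<rho>)", OF v])
        show "measure lebesgue (U \<rho>0) \<le> v powr real DIM('a)" using V0 by (simp add: U_def)
        show "antimono (\<lambda>\<rho>. measure lebesgue (U \<rho>))"
          using Um by (intro antimonoI measure_mono_fmeasurable) (auto simp: U_def)
        show "0 \<le> measure lebesgue (U \<rho>)" for \<rho> by simp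
        fix \<rho> \<rho>' assume \<rho>: "\<rho>0 \<le> \<rho>" "\<rho> < \<rho>'"
        show "measure lebesgue (U \<rho>') \<le> A * (measure lebesgue (U \<rho>) / (\<rho>' - \<rho>) powr (\<delta> * p)) powr (real DIM('a) / (real DIM('a) - \<delta> * p))"
          unfolding U_def[of \<rho>']
        proof (rule A(2)[OF cut TB _ \<rho>(2) Uo])
          show "r \<le> \<rho>" using r \<rho> by simp
          show "emeasure lebesgue (U \<rho>) < \<infinity>"
            using fmeasurableD2[OF Um[of \<rho>]] by (metis infinity_ennreal_def top.not_eq_extremum)
          fix x y assume "ramp T w \<rho> \<rho>' x \<noteq> ramp T w \<rho> \<rho>' y"
          moreover have "ramp T w \<rho> \<rho>' a = 0" if "a \<notin> U \<rho>" for a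
            using that \<rho> by (auto simp: ramp_def U_def divide_nonpos_pos)
          ultimately show "x \<in> U \<rho> \<or> y \<in> U \<rho>" by metis
        qed
      qed
      then have "negligible (U (\<rho>0 + K * v))"
        using Um by (simp add: negligible_iff_measure)
      then have "U (\<rho>0 + K * v) = {}" using open_not_negligible Uo by blast
      then show "T \<subseteq> cball w (\<rho>0 + K * v)" by (fastforce simp: U_def dist_commute)
    qed
  qed
qed

text \<open>
  All of \<open>G\<close> outside a fixed ball in \<open>G\<close> is a piece cut off by that ball, and it has finite volume.
\<close>
lemma bounded_of_fractional_sobolev_poincare:
  fixes G :: "'a::euclidean_space set" and \<delta> p :: real
  assumes par: "0 < \<delta>" "\<delta> < 1" "1 \<le> p" "\<delta> * p < real DIM('a)"
    and SP: "fractional_sobolev_poincare C \<delta> p G" "C > 0"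
    and G: "open G" "emeasure lebesgue G < \<infinity>"
  shows "bounded G"
proof (cases "G = {}")
  case False
  then obtain x0 where x0: "x0 \<in> G" by blast
  then obtain R where R: "R > 0" "ball x0 R \<subseteq> G" using G openE by blast
  have B0: "open (ball x0 R)" "ball x0 R \<subseteq> G" "ball x0 R \<noteq> {}" using R by auto
  show ?thesis
  proof (rule cut_off_piece_subset_cball[OF par SP G B0])
    fix K :: real
    assume K: "K > 0" "\<And>T w r \<rho>0 v. \<lbrakk>cut_off_by_cball G T w r; T \<inter> ball x0 R = {}; r \<le> \<rho>0; v > 0;
        measure lebesgue {x\<in>T. \<rho>0 < dist x w} \<le> v powr real DIM('a)\<rbrakk>
      \<Longrightarrow> T \<subseteq> cball w (\<rho>0 + K * v)"
    define T where "T = G - cball x0 R"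
    define g where "g = measure lebesgue G"
    \<comment> \<open>The summand 1 keeps \<open>v\<close> positive.\<close>
    define v where "v = (g + 1) powr (1 / real DIM('a))"
    have "g \<ge> 0" by (simp add: g_def)
    then have v: "v > 0" "v powr real DIM('a) = g + 1" by (auto simp: v_def powr_powr)
    have G': "G \<in> lmeasurable" using G by (auto intro!: fmeasurableI)
    have oW: "open {x\<in>T. R < dist x x0}"
    proof -
      have "{x\<in>T. R < dist x x0} = G - cball x0 R" by (auto simp: T_def dist_commute)
      then show ?thesis using G by auto
    qed
    have "measure lebesgue {x\<in>T. R < dist x x0} \<le> g" unfolding g_def
      using G' oW by (intro measure_mono_fmeasurable) (auto simp: T_def)
    then have "measure lebesgue {x\<in>T. R < dist x x0} \<le> v powr real DIM('a)" using v by simp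
    moreover have "cut_off_by_cball G T x0 R"
      using G by (auto simp: cut_off_by_cball_def T_def dist_commute intro!: bexI[OF _ ends_in_segment(2)])
    moreover have "T \<inter> ball x0 R = {}" by (auto simp: T_def)
    ultimately have "T \<subseteq> cball x0 (R + K * v)" using K(2)[of T x0 R R v] v(1) by simp
    then have "G \<subseteq> cball x0 (R + K * v) \<union> cball x0 R" by (auto simp: T_def)
    then show ?thesis using bounded_subset by (metis bounded_Un bounded_cball)
  qed
qed simp

text \<open>
  What is missing in the preceding bound is an initial volume of order \<open>d(w)\<^sup>n\<close>. For it, the ramp
  rises between \<open>r = C0 d(w)\<close> and \<open>R = 2r + d(w)\<close>, and \<open>S = B(w, R)\<close>. This \<open>S\<close> is large enough:
  if \<open>x\<close> and \<open>y\<close> are both outside \<open>B(w, R)\<close> and \<open>u(x) \<noteq> u(y)\<close>, then just one of them is in \<open>T\<close>,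
  the segment between them meets the closed ball of radius \<open>r\<close>, and
  \<open>|x - w| + |y - w| - 2r \<le> |x - y| < d(x) \<le> |x - w| + d(w)\<close> contradicts \<open>|y - w| \<ge> R\<close>.
\<close>
lemma cut_off_piece_subset_proportional_cball:
  fixes G B0 :: "'a::euclidean_space set" and \<delta> p C0 :: real
  assumes par: "0 < \<delta>" "\<delta> < 1" "1 \<le> p" "\<delta> * p < real DIM('a)"
    and SP: "fractional_sobolev_poincare C \<delta> p G" "C > 0"
    and G: "open G" "emeasure lebesgue G < \<infinity>"
    and B0: "open B0" "B0 \<subseteq> G" "B0 \<noteq> {}" and C0: "C0 > 0"
  obtains M where "M > 0"
    "\<And>T w. \<lbrakk>cut_off_by_cball G T w (C0 * bdist G w); T \<inter> B0 = {}; bdist G w > 0\<rbrakk>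
      \<Longrightarrow> T \<subseteq> cball w (M * bdist G w)"
proof (rule weak_type_inequality[OF par SP G B0], rule cut_off_piece_subset_cball[OF par SP G B0])
  fix A K :: real
  assume A: "A > 0"
    "\<And>T w r \<rho> \<rho>' S. \<lbrakk>cut_off_by_cball G T w r; T \<inter> B0 = {}; r \<le> \<rho>; \<rho> < \<rho>'; open S; emeasure lebesgue S < \<infinity>;
        \<And>x y. \<lbrakk>x \<in> G; y \<in> ball x (bdist G x); ramp T w \<rho> \<rho>' x \<noteq> ramp T w \<rho> \<rho>' y\<rbrakk> \<Longrightarrow> x \<in> S \<or> y \<in> S\<rbrakk>
      \<Longrightarrow> measure lebesgue {x\<in>T. \<rho>' < dist x w}
        \<le> A * (measure lebesgue S / (\<rho>' - \<rho>) powr (\<delta> * p)) powr (real DIM('a) / (real DIM('a) - \<delta> * p))"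
   and K: "K > 0" "\<And>T w r \<rho>0 v. \<lbrakk>cut_off_by_cball G T w r; T \<inter> B0 = {}; r \<le> \<rho>0; v > 0;
        measure lebesgue {x\<in>T. \<rho>0 < dist x w} \<le> v powr real DIM('a)\<rbrakk>
      \<Longrightarrow> T \<subseteq> cball w (\<rho>0 + K * v)"
  define n where "n = real DIM('a)"
  define \<sigma> where "\<sigma> = \<delta> * p"
  define \<beta> where "\<beta> = n / (n - \<sigma>)"
  have n: "0 < \<sigma>" "\<sigma> < n" "n > 0" using par by (auto simp: n_def \<sigma>_def)
  define \<omega> where "\<omega> = unit_ball_vol n"
  have \<omega>: "\<omega> > 0" using n by (simp add: \<omega>_def)
  define a where "a = 2 * C0 + 1"
  define b where "b = C0 + 1"
  have ab: "a > 0" "b > 0" using C0 by (auto simp: a_def b_def)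
  define Q where "Q = (A * (\<omega> * a powr n / b powr \<sigma>) powr \<beta>) powr (1 / n)"
  have Q: "Q > 0" "Q powr n = A * (\<omega> * a powr n / b powr \<sigma>) powr \<beta>"
    using A(1) \<omega> ab n by (auto simp: Q_def powr_powr)
  show thesis
  proof (rule that[of "a + K * Q"])
    show "a + K * Q > 0" using ab K(1) Q by (simp add: add_pos_pos)
    fix T :: "'a set" and w
    assume cut: "cut_off_by_cball G T w (C0 * bdist G w)" and TB: "T \<inter> B0 = {}" and pos: "bdist G w > 0"
    define d where "d = bdist G w"
    have d: "d > 0" using pos by (simp add: d_def)
    define r where "r = C0 * d"
    define R where "R = a * d"
    have R: "R - r = b * d" "R = 2 * r + d" by (auto simp: R_def r_def a_def b_def algebra_simps)
    have rR: "r < R" using R(1) ab d by (smt (verit) mult_pos_pos)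
    have cut': "cut_off_by_cball G T w r" using cut by (simp add: r_def d_def)
    have supp: "x \<in> ball w R \<or> y \<in> ball w R"
      if x: "x \<in> G" and y: "y \<in> ball x (bdist G x)" and ne: "ramp T w r R x \<noteq> ramp T w r R y" for x y
    proof (rule ccontr)
      assume "\<not> ?thesis"
      then have far: "R \<le> dist x w" "R \<le> dist y w" by (auto simp: dist_commute)
      have yG: "y \<in> G" using ball_bdist_subset x y by blast
      have seg: "closed_segment x y \<subseteq> G" using ball_segment_subset[OF x y] .
      have dxy: "dist x y < dist x w + d" using y bdist_triangle[of G x w] by (simp add: d_def)
      have one: "ramp T w r R z = 1" if "z \<in> T" "R \<le> dist z w" for z
        using that rR by (simp add: ramp_def)
      have zero: "ramp T w r R z = 0" if "z \<notin> T" for z using that by (simp add: ramp_def)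
      have mixed: "(x \<in> T \<and> y \<notin> T) \<or> (x \<notin> T \<and> y \<in> T)" using one zero far ne by metis
      have sum: "dist x w + dist y w \<le> dist x y + 2 * r"
        using mixed cut_off_crossing(1)[OF cut', of x y] cut_off_crossing(1)[OF cut', of y x] x yG seg
        by (auto simp: dist_commute closed_segment_commute)
      then show False using dxy far R(2) by linarith
    qed
    have "measure lebesgue {x\<in>T. R < dist x w} \<le> A * (measure lebesgue (ball w R) / (R - r) powr \<sigma>) powr \<beta>"
      unfolding \<sigma>_def \<beta>_def n_def
    proof (rule A(2)[OF cut' TB _ rR])
      show "emeasure lebesgue (ball w R) < \<infinity>" using lmeasurable_ball[of w R] by (simp add: fmeasurable_def)
    qed (use supp in auto)
    also have "measure lebesgue (ball w R) = \<omega> * a powr n * d powr n"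
    proof -
      have "measure lebesgue (ball w R) = \<omega> * R ^ DIM('a)"
        using content_ball[of R w] ab d by (simp add: R_def \<omega>_def n_def)
      then show ?thesis using ab d by (simp add: R_def n_def powr_realpow power_mult_distrib)
    qed
    also have "\<omega> * a powr n * d powr n / (R - r) powr \<sigma> = (\<omega> * a powr n / b powr \<sigma>) * d powr (n - \<sigma>)"
      unfolding R(1) using ab d by (simp add: powr_mult powr_diff)
    also have "A * \<dots> powr \<beta> = Q powr n * d powr n"
    proof -
      have "(d powr (n - \<sigma>)) powr \<beta> = d powr n" using n by (simp add: powr_powr \<beta>_def)
      then have "(c * d powr (n - \<sigma>)) powr \<beta> = c powr \<beta> * d powr n" for c by (simp add: powr_mult)
      then show ?thesis by (simp only: Q(2) mult.assoc)
    qed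
    also have "\<dots> = (Q * d) powr n" using Q d by (simp add: powr_mult)
    finally have "measure lebesgue {x\<in>T. R < dist x w} \<le> (Q * d) powr real DIM('a)" by (simp add: n_def)
    then have "T \<subseteq> cball w (R + K * (Q * d))"
      using cut' TB rR Q d by (intro K(2)) auto
    also have "R + K * (Q * d) = (a + K * Q) * bdist G w" by (simp add: R_def d_def algebra_simps)
    finally show "T \<subseteq> cball w ((a + K * Q) * bdist G w)" .
  qed
qed

section \<open>From the separation property to diameter carrots\<close>

text \<open>A segment in \<open>G\<close> that avoids the sphere is connected and cannot leave a component.\<close>
lemma component_cut_off_by_cball:
  assumes "open G"
  shows "cut_off_by_cball G (connected_component_set (G - sphere w r) y) w r"
  unfolding cut_off_by_cball_def
proof (intro conjI ballI impI)
  let ?T = "connected_component_set (G - sphere w r) y"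
  show "open ?T" using assms by (intro open_connected_component open_Diff) auto
  show "?T \<subseteq> G" using connected_component_subset by fastforce
  fix a b assume a: "a \<in> ?T" and b: "b \<in> G - ?T" and seg: "closed_segment a b \<subseteq> G"
  have "closed_segment a b \<inter> sphere w r \<noteq> {}"
  proof
    assume "closed_segment a b \<inter> sphere w r = {}"
    then have "closed_segment a b \<subseteq> G - sphere w r" using seg by blast
    then have "connected_component (G - sphere w r) a b"
      by (rule connected_componentI[OF connected_segment(1)]) simp_all
    then have "b \<in> ?T" using a by (auto intro: connected_component_trans)
    then show False using b by blast
  qed
  then show "\<exists>z\<in>closed_segment a b. dist z w \<le> r" by (force simp: dist_commute)
qed

text \<open>
  Let \<open>w = \<gamma>(t)\<close>, \<open>r = C0 d(w)\<close> and \<open>y = \<gamma>(s)\<close> with \<open>s \<le> t\<close> and \<open>|y - w| > r\<close>. If the closed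
  ball of radius \<open>r\<close> around \<open>w\<close> misses the ball \<open>B0\<close> around \<open>x0\<close>, then the component of \<open>y\<close> off
  the sphere is a piece that does not contain \<open>x0\<close>, hence is disjoint from the connected set \<open>B0\<close>, and its
  size is bounded by a multiple of \<open>d(w)\<close>. If the ball meets \<open>B0\<close>, then \<open>d(w)\<close> is bounded below by a
  constant, and the diameter of \<open>G\<close> is a bound; this case also covers \<open>x0\<close> inside the ball or on the
  sphere, where the separation property says nothing.
\<close>
lemma separation_diameter_carrots:
  fixes G :: "'a::euclidean_space set" and \<delta> p :: real
  assumes par: "0 < \<delta>" "\<delta> < 1" "1 \<le> p" "\<delta> * p < real DIM('a)"
    and SP: "fractional_sobolev_poincare C \<delta> p G" "C > 0"
    and fin: "emeasure lebesgue G < \<infinity>" and sep: "separation_property G x0"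
  obtains M where "M \<ge> 1"
    "\<And>x. x \<in> G \<Longrightarrow> \<exists>\<gamma>. path \<gamma> \<and> path_image \<gamma> \<subseteq> G \<and> pathstart \<gamma> = x \<and> pathfinish \<gamma> = x0 \<and>
        (\<forall>s t. 0 \<le> s \<longrightarrow> s \<le> t \<longrightarrow> t \<le> 1 \<longrightarrow> dist (\<gamma> s) (\<gamma> t) \<le> M * bdist G (\<gamma> t))"
proof -
  have dom: "is_domain G" "G \<noteq> UNIV" and x0: "x0 \<in> G" using sep by (auto simp: separation_property_def)
  have G: "open G" using dom by (simp add: is_domain_def)
  obtain C0 where C0: "C0 > 0" and curves: "\<forall>x\<in>G. \<exists>\<gamma>. path \<gamma> \<and> path_image \<gamma> \<subseteq> G \<and> pathstart \<gamma> = x \<and> pathfinish \<gamma> = x0 \<and>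
        (\<forall>t\<in>{0..1}. let B = ball (\<gamma> t) (C0 * bdist G (\<gamma> t)) in
            \<gamma> ` {0..t} \<subseteq> B \<or>
            (\<forall>y \<in> \<gamma> ` {0..t} - B. \<not> (\<exists>T \<in> components (G - frontier B). y \<in> T \<and> x0 \<in> T)))"
    using sep unfolding separation_property_def by blast
  obtain D where D: "\<And>x y. x \<in> G \<Longrightarrow> y \<in> G \<Longrightarrow> dist x y \<le> D"
    using bounded_of_fractional_sobolev_poincare[OF par SP G fin] by (auto simp: bounded_two_points)
  define d0 where "d0 = bdist G x0"
  have d0: "d0 > 0" using bdist_pos[OF dom x0] by (simp add: d0_def)
  define B0 where "B0 = ball x0 (d0 / 2)"
  have B0: "open B0" "B0 \<subseteq> G" "B0 \<noteq> {}"
    using ball_bdist_subset[OF x0] d0 by (auto simp: B0_def d0_def)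
  show thesis
  proof (rule cut_off_piece_subset_proportional_cball[OF par SP G fin B0 C0])
    fix M1 :: real
    assume M1: "M1 > 0" "\<And>T w. \<lbrakk>cut_off_by_cball G T w (C0 * bdist G w); T \<inter> B0 = {}; bdist G w > 0\<rbrakk>
      \<Longrightarrow> T \<subseteq> cball w (M1 * bdist G w)"
    define M2 where "M2 = D * (2 * (1 + C0) / d0)"
    have D0: "D \<ge> 0" using D[OF x0 x0] by simp
    define M where "M = 1 + C0 + M1 + M2"
    have M2: "M2 \<ge> 0" using D0 C0 d0 by (simp add: M2_def)
    have MM: "C0 * b \<le> M * b" "M1 * b \<le> M * b" "M2 * b \<le> M * b" if "b \<ge> 0" for b
      using that C0 M1(1) M2 by (auto simp: M_def intro!: mult_right_mono)
    show thesis
    proof (rule that[of M])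
      show "M \<ge> 1" using C0 M1(1) M2 by (simp add: M_def)
      fix x assume "x \<in> G"
      from bspec[OF curves this] obtain \<gamma> where \<gamma>: "path \<gamma> \<and> path_image \<gamma> \<subseteq> G \<and> pathstart \<gamma> = x \<and> pathfinish \<gamma> = x0 \<and>
        (\<forall>t\<in>{0..1}. let B = ball (\<gamma> t) (C0 * bdist G (\<gamma> t)) in
            \<gamma> ` {0..t} \<subseteq> B \<or>
            (\<forall>y \<in> \<gamma> ` {0..t} - B. \<not> (\<exists>T \<in> components (G - frontier B). y \<in> T \<and> x0 \<in> T)))"
        by (rule exE)
      then have \<gamma>': "path \<gamma>" "path_image \<gamma> \<subseteq> G" "pathstart \<gamma> = x" "pathfinish \<gamma> = x0"
        by - (elim conjE, assumption)+
      from \<gamma> have "\<forall>t\<in>{0..1}. let B = ball (\<gamma> t) (C0 * bdist G (\<gamma> t)) in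
            \<gamma> ` {0..t} \<subseteq> B \<or>
            (\<forall>y \<in> \<gamma> ` {0..t} - B. \<not> (\<exists>T \<in> components (G - frontier B). y \<in> T \<and> x0 \<in> T))"
        by (elim conjE)
      then have alt: "\<gamma> ` {0..t} \<subseteq> ball (\<gamma> t) (C0 * bdist G (\<gamma> t)) \<or>
            (\<forall>y \<in> \<gamma> ` {0..t} - ball (\<gamma> t) (C0 * bdist G (\<gamma> t)).
              \<not> (\<exists>T \<in> components (G - frontier (ball (\<gamma> t) (C0 * bdist G (\<gamma> t)))). y \<in> T \<and> x0 \<in> T))"
        if "t \<in> {0..1}" for t using that unfolding Let_def by (rule bspec)
      have "dist (\<gamma> s) (\<gamma> t) \<le> M * bdist G (\<gamma> t)" if st: "0 \<le> s" "s \<le> t" "t \<le> 1" for s t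
      proof -
        define w where "w = \<gamma> t"
        define y where "y = \<gamma> s"
        define r where "r = C0 * bdist G w"
        have wG: "w \<in> G" and yG: "y \<in> G" using \<gamma>'(2) st by (auto simp: w_def y_def path_image_def)
        have dw: "bdist G w > 0" by (rule bdist_pos[OF dom wG])
        have r: "r > 0" using C0 dw by (simp add: r_def)
        consider "dist y w \<le> r" | "cball w r \<inter> B0 \<noteq> {}" | "r < dist y w" "cball w r \<inter> B0 = {}" by linarith
        then have "dist y w \<le> M * bdist G w"
        proof cases
          case 1
          then have "dist y w \<le> C0 * bdist G w" by (simp add: r_def)
          then show ?thesis using MM(1)[of "bdist G w"] dw by linarith
        next
          case 2
          then obtain b where b: "dist w b \<le> r" "dist x0 b < d0 / 2" by (auto simp: B0_def)
          have "d0 \<le> bdist G w + dist x0 w" unfolding d0_def by (rule bdist_triangle)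
          also have "dist x0 w \<le> dist x0 b + dist w b" by (metis dist_commute dist_triangle)
          finally have "d0 / 2 \<le> (1 + C0) * bdist G w" using b by (simp add: r_def algebra_simps)
          then have "1 \<le> 2 * (1 + C0) / d0 * bdist G w" using d0 by (simp add: field_simps)
          then have "D * 1 \<le> D * (2 * (1 + C0) / d0 * bdist G w)" using D0 by (intro mult_left_mono) auto
          then have "D \<le> M2 * bdist G w" by (simp add: M2_def)
          then show ?thesis using D[OF yG wG] MM(3)[of "bdist G w"] dw by linarith
        next
          case 3
          define H where "H = G - sphere w r"
          define T where "T = connected_component_set H y"
          have yH: "y \<in> H" using 3(1) yG by (auto simp: H_def dist_commute)
          then have yT: "y \<in> T" by (simp add: T_def)
          have B0H: "B0 \<subseteq> H" using 3(2) B0(2) by (auto simp: H_def)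
          have x0B: "x0 \<in> B0" using d0 by (simp add: B0_def)
          have comp: "T \<in> components H" using yH by (auto simp: T_def components_def)
          have "x0 \<notin> T"
          proof
            assume x0T: "x0 \<in> T"
            have y_mem: "y \<in> \<gamma> ` {0..t} - ball (\<gamma> t) (C0 * bdist G (\<gamma> t))"
              using 3(1) st by (auto simp: y_def w_def r_def dist_commute)
            have "\<not> (\<exists>T \<in> components (G - frontier (ball (\<gamma> t) (C0 * bdist G (\<gamma> t)))). y \<in> T \<and> x0 \<in> T)"
            proof -
              have tt: "t \<in> {0..1}" using st by simp
              have "\<not> \<gamma> ` {0..t} \<subseteq> ball (\<gamma> t) (C0 * bdist G (\<gamma> t))" using y_mem by blast
              with alt[OF tt] show ?thesis using y_mem by (elim disjE) (simp, rule bspec)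
            qed
            moreover have "frontier (ball (\<gamma> t) (C0 * bdist G (\<gamma> t))) = sphere w r"
              using r by (simp add: w_def r_def)
            ultimately show False using comp yT x0T by (auto simp: H_def)
          qed
          moreover have "x0 \<in> T" if "b \<in> T" "b \<in> B0" for b
          proof -
            have "connected_component H b x0"
              using B0H that x0B by (intro connected_component_of_subset[OF connected_componentI[of B0]]) (auto simp: B0_def)
            then show ?thesis using that(1) by (auto simp: T_def intro: connected_component_trans)
          qed
          ultimately have TB: "T \<inter> B0 = {}" by blast
          have "T \<subseteq> cball w (M1 * bdist G w)"
            using component_cut_off_by_cball[OF G, of w r y] TB dw
            by (intro M1(2)) (auto simp: T_def H_def r_def)
          then have "dist y w \<le> M1 * bdist G w" using yT by (auto simp: dist_commute)
          then show ?thesis using MM(2)[of "bdist G w"] dw by linarith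
        qed
        then show ?thesis by (simp add: w_def y_def)
      qed
      then show "\<exists>\<gamma>. path \<gamma> \<and> path_image \<gamma> \<subseteq> G \<and> pathstart \<gamma> = x \<and> pathfinish \<gamma> = x0 \<and>
        (\<forall>s t. 0 \<le> s \<longrightarrow> s \<le> t \<longrightarrow> t \<le> 1 \<longrightarrow> dist (\<gamma> s) (\<gamma> t) \<le> M * bdist G (\<gamma> t))"
        using \<gamma>' by (intro exI[of _ \<gamma>] conjI allI impI) simp_all
    qed
  qed
qed

section \<open>From diameter carrots to the John condition\<close>

text \<open>
  After rescaling by \<open>s\<close> the set lies in one compact ball, which is covered by finitely many balls of
  diameter \<open>\<epsilon>\<close>, each containing at most one of the points.
\<close>
lemma packing_bound:
  fixes \<epsilon> R :: real
  assumes "\<epsilon> > 0"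
  obtains N :: nat where
    "\<And>(c :: 'a::euclidean_space) s X. \<lbrakk>s > 0; X \<subseteq> cball c (R * s); \<And>x y. x \<in> X \<Longrightarrow> y \<in> X \<Longrightarrow> x \<noteq> y \<Longrightarrow> dist x y \<ge> \<epsilon> * s\<rbrakk>
       \<Longrightarrow> finite X \<and> card X \<le> N"
proof -
  have "compact (cball (0::'a) R)" by simp
  then obtain F where F: "finite F" "cball (0::'a) R \<subseteq> (\<Union>x\<in>F. ball x (\<epsilon>/2))"
    using assms unfolding compact_eq_totally_bounded by (meson half_gt_zero)
  show thesis
  proof (rule that[of "card F"])
    fix c :: 'a and s X
    assume s: "s > 0" and X: "X \<subseteq> cball c (R * s)"
      and sep: "\<And>x y. x \<in> X \<Longrightarrow> y \<in> X \<Longrightarrow> x \<noteq> y \<Longrightarrow> dist x y \<ge> \<epsilon> * s"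
    have "\<exists>f\<in>F. dist f ((x - c) /\<^sub>R s) < \<epsilon>/2" if "x \<in> X" for x
    proof -
      have "norm (x - c) \<le> R * s" using X that by (auto simp: dist_norm norm_minus_commute)
      then have "norm ((x - c) /\<^sub>R s) \<le> R" using s pos_divide_le_eq[of s "norm (x - c)" R] by (simp add: divide_inverse_commute)
      then have "(x - c) /\<^sub>R s \<in> cball 0 R" by simp
      with F(2) have "(x - c) /\<^sub>R s \<in> (\<Union>f\<in>F. ball f (\<epsilon>/2))" by (rule subsetD)
      then show ?thesis by (simp only: UN_iff mem_ball)
    qed
    then obtain f where f: "\<And>x. x \<in> X \<Longrightarrow> f x \<in> F" "\<And>x. x \<in> X \<Longrightarrow> dist (f x) ((x - c) /\<^sub>R s) < \<epsilon>/2"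
      by metis
    have "inj_on f X"
    proof (rule inj_onI, rule ccontr)
      fix x y assume xy: "x \<in> X" "y \<in> X" "f x = f y" "x \<noteq> y"
      have "dist ((x - c) /\<^sub>R s) ((y - c) /\<^sub>R s) < \<epsilon>"
        using f(2)[OF xy(1)] f(2)[OF xy(2)] xy(3) by (metis dist_triangle_half_r)
      moreover have "dist ((x - c) /\<^sub>R s) ((y - c) /\<^sub>R s) = dist x y / s"
      proof -
        have "(x - c) /\<^sub>R s - (y - c) /\<^sub>R s = (x - y) /\<^sub>R s"
          by (simp add: scaleR_diff_right)
        then show ?thesis using s by (simp add: dist_norm divide_inverse_commute)
      qed
      ultimately have "dist x y / s < \<epsilon>" by linarith
      then show False using sep[OF xy(1,2,4)] s by (simp add: pos_divide_less_eq)
    qed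
    moreover have "f ` X \<subseteq> F" using f by auto
    ultimately show "finite X \<and> card X \<le> card F"
      using F(1) by (meson card_inj_on_le inj_on_finite)
  qed
qed

text \<open>
  For \<open>j < i\<close> the two distance bounds give \<open>d\<^sub>j \<le> 2M d\<^sub>i\<close>. If \<open>d\<^sub>j\<^sub>+\<^sub>m < 2 d\<^sub>j\<close>, then the points
  \<open>z\<^sub>j, \<dots>, z\<^sub>j\<^sub>+\<^sub>m\<^sub>-\<^sub>1\<close> all lie within \<open>2M d\<^sub>j\<close> of \<open>z\<^sub>j\<^sub>+\<^sub>m\<close> and have mutual distances at
  least \<open>d\<^sub>j/(4M)\<close>, so \<open>m\<close> does not exceed the packing number. For larger \<open>m\<close>, the values at indices
  \<open>m\<close> apart double at least, and the sum is dominated by a geometric series with \<open>m\<close> terms of each size.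
\<close>
lemma separated_sequence_sum_bound:
  fixes M :: real
  assumes M: "M \<ge> 1"
  obtains C where "C > 0"
    "\<And>(z :: nat \<Rightarrow> 'a::euclidean_space) d k. \<lbrakk>\<And>i. i \<le> k \<Longrightarrow> d i > 0;
        \<And>i j. j < i \<Longrightarrow> i \<le> k \<Longrightarrow> d j / 2 \<le> dist (z j) (z i);
        \<And>i j. j < i \<Longrightarrow> i \<le> k \<Longrightarrow> dist (z j) (z i) \<le> M * d i\<rbrakk>
       \<Longrightarrow> (\<Sum>j<k. d j) \<le> C * d k"
proof -
  have "1 / (4 * M) > 0" using M by simp
  then obtain N :: nat where N: "\<And>(c :: 'a::euclidean_space) s X. \<lbrakk>s > 0; X \<subseteq> cball c (2 * M * s);
      \<And>x y. x \<in> X \<Longrightarrow> y \<in> X \<Longrightarrow> x \<noteq> y \<Longrightarrow> dist x y \<ge> 1 / (4 * M) * s\<rbrakk> \<Longrightarrow> finite X \<and> card X \<le> N"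
    using packing_bound[of "1 / (4 * M)" "2 * M"] by blast
  define m where "m = N + 1"
  have m: "real m > 0" by (simp add: m_def)
  show thesis
  proof (rule that[of "4 * M * real m"])
    show "4 * M * real m > 0" using M m by simp
    fix z :: "nat \<Rightarrow> 'a" and d :: "nat \<Rightarrow> real" and k
    assume pos: "\<And>i. i \<le> k \<Longrightarrow> d i > 0"
      and lo: "\<And>i j. j < i \<Longrightarrow> i \<le> k \<Longrightarrow> d j / 2 \<le> dist (z j) (z i)"
      and up: "\<And>i j. j < i \<Longrightarrow> i \<le> k \<Longrightarrow> dist (z j) (z i) \<le> M * d i"
    have comp: "d j \<le> 2 * M * d i" if "j \<le> i" "i \<le> k" for i j
    proof (cases "j = i")
      case True
      have "1 * d i \<le> 2 * M * d i" using M pos[OF that(2)] by (intro mult_right_mono) auto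
      then show ?thesis using True by simp
    next
      case False
      then show ?thesis using lo[of j i] up[of j i] that by simp
    qed
    have double: "2 * d j \<le> d (j + m)" if jk: "j + m \<le> k" for j
    proof (rule ccontr)
      assume "\<not> 2 * d j \<le> d (j + m)"
      then have small: "d (j + m) < 2 * d j" by simp
      have dj: "d j > 0" using pos jk by simp
      define X where "X = z ` {j..<j + m}"
      have sep: "dist (z a) (z b) \<ge> 1 / (4 * M) * d j" if "j \<le> a" "a < b" "b < j + m" for a b
      proof -
        have "d j \<le> 2 * M * d a" "d a \<le> 2 * dist (z a) (z b)" using lo[of a b] comp[of j a] that jk by auto
        moreover have "2 * M * d a \<le> 2 * M * (2 * dist (z a) (z b))"
          using calculation(2) M by (intro mult_left_mono) auto
        ultimately have "d j \<le> 2 * M * (2 * dist (z a) (z b))" by linarith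
        then show ?thesis using M by (simp add: field_simps)
      qed
      have sep': "dist (z a) (z b) \<ge> 1 / (4 * M) * d j" if "a \<in> {j..<j+m}" "b \<in> {j..<j+m}" "a \<noteq> b" for a b
        using sep[of a b] sep[of b a] that by (cases "a < b") (auto simp: dist_commute)
      have inj: "inj_on z {j..<j + m}"
      proof (rule inj_onI, rule ccontr)
        fix a b assume "a \<in> {j..<j+m}" "b \<in> {j..<j+m}" "z a = z b" "a \<noteq> b"
        then have "1 / (4 * M) * d j \<le> 0" using sep'[of a b] by simp
        then show False using M dj by (simp add: field_simps)
      qed
      have "X \<subseteq> cball (z (j + m)) (2 * M * d j)"
      proof
        fix x assume "x \<in> X"
        then obtain a where a: "x = z a" "a < j + m" by (auto simp: X_def)
        have "dist (z a) (z (j + m)) \<le> M * d (j + m)" using up a jk by simp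
        also have "\<dots> \<le> M * (2 * d j)" using small M by (intro mult_left_mono) auto
        finally show "x \<in> cball (z (j + m)) (2 * M * d j)" using a by (simp add: dist_commute)
      qed
      then have "card X \<le> N" using N[OF dj, of X] sep' unfolding X_def by blast
      then show False using inj by (simp add: X_def card_image m_def)
    qed
    have "i \<le> k \<longrightarrow> (\<Sum>j<i. d j) \<le> 4 * M * real m * d i" for i
    proof (induction i rule: less_induct)
      case (less i)
      show ?case
      proof
        assume ik: "i \<le> k"
        have part: "(\<Sum>j\<in>{a..<i}. d j) \<le> real (i - a) * (2 * M * d i)" for a
          using sum_bounded_above[of "{a..<i}" d "2 * M * d i"] comp ik by simp
        have Md: "2 * M * d i \<ge> 0" using M pos[OF ik] by simp
        show "(\<Sum>j<i. d j) \<le> 4 * M * real m * d i"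
        proof (cases "i \<le> m")
          case True
          have "(\<Sum>j<i. d j) \<le> real i * (2 * M * d i)" using part[of 0] by (simp add: lessThan_atLeast0)
          also have "\<dots> \<le> real m * (2 * M * d i)" using True Md by (intro mult_right_mono) auto
          also have "\<dots> \<le> 2 * (real m * (2 * M * d i))" using m Md by simp
          finally show ?thesis by (simp add: ac_simps)
        next
          case False
          then have "i - m < i" "i - m \<le> k" using ik by (auto simp: m_def)
          then have IH: "(\<Sum>j<i - m. d j) \<le> 4 * M * real m * d (i - m)" using less.IH by blast
          have "(\<Sum>j<i. d j) = (\<Sum>j<i - m. d j) + (\<Sum>j\<in>{i - m..<i}. d j)"
            by (simp add: lessThan_atLeast0 sum.atLeastLessThan_concat)
          also have "\<dots> \<le> 4 * M * real m * d (i - m) + real m * (2 * M * d i)"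
            using IH part[of "i - m"] False by simp
          also have "4 * M * real m * d (i - m) \<le> 4 * M * real m * (d i / 2)"
            using double[of "i - m"] False ik M by (intro mult_left_mono) auto
          finally show ?thesis by (simp add: algebra_simps)
        qed
      qed
    qed
    then show "(\<Sum>j<k. d j) \<le> 4 * M * real m * d k" by blast
  qed
qed

lemma last_exit_time:
  fixes \<gamma> :: "real \<Rightarrow> 'a::metric_space"
  assumes \<gamma>: "continuous_on {0..1} \<gamma>" and t: "t \<in> {0..1}" and r: "0 \<le> r"
  obtains s where "t \<le> s" "s \<le> 1" "dist (\<gamma> t) (\<gamma> s) \<le> r"
    "s < 1 \<longrightarrow> (\<forall>a\<in>{s..1}. r \<le> dist (\<gamma> t) (\<gamma> a))"
proof -
  define X where "X = {s\<in>{t..1}. dist (\<gamma> t) (\<gamma> s) \<le> r}"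
  have c: "continuous_on {t..1} (\<lambda>s. dist (\<gamma> t) (\<gamma> s))"
    using t by (intro continuous_intros continuous_on_subset[OF \<gamma>]) auto
  have "X = {t..1} \<inter> (\<lambda>s. dist (\<gamma> t) (\<gamma> s)) -` {..r}" by (auto simp: X_def)
  then have "closed X" using continuous_closed_preimage[OF c, of "{..r}"] by simp
  moreover have "bounded X" by (rule bounded_subset[of "{t..1}"]) (auto simp: X_def)
  ultimately have "compact X" by (simp add: compact_eq_bounded_closed)
  moreover have "t \<in> X" using t r by (auto simp: X_def)
  ultimately obtain s where s: "s \<in> X" "\<And>a. a \<in> X \<Longrightarrow> a \<le> s"
    using compact_attains_sup[of X] by blast
  show thesis
  proof (rule that[of s])
    show "t \<le> s" "s \<le> 1" "dist (\<gamma> t) (\<gamma> s) \<le> r" using s(1) by (auto simp: X_def)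
    show "s < 1 \<longrightarrow> (\<forall>a\<in>{s..1}. r \<le> dist (\<gamma> t) (\<gamma> a))"
    proof (intro impI ballI)
      fix a assume s1: "s < 1" and a: "a \<in> {s..1}"
      show "r \<le> dist (\<gamma> t) (\<gamma> a)"
      proof (rule continuous_ge_on_closure[of "{s<..1}" "\<lambda>s. dist (\<gamma> t) (\<gamma> s)"])
        show "continuous_on (closure {s<..1}) (\<lambda>s. dist (\<gamma> t) (\<gamma> s))"
          using s1 \<open>t \<le> s\<close> by (auto intro: continuous_on_subset[OF c])
        show "a \<in> closure {s<..1}" using a s1 by simp
        fix b assume "b \<in> {s<..1}"
        then have "b \<notin> X" using s(2)[of b] by auto
        then show "r \<le> dist (\<gamma> t) (\<gamma> b)" using \<open>b \<in> {s<..1}\<close> \<open>t \<le> s\<close> by (auto simp: X_def)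
      qed
    qed
  qed
qed

text \<open>
  The points are \<open>z\<^sub>i = \<gamma>(\<tau>\<^sub>i)\<close>, where \<open>\<tau>\<^sub>0 = 0\<close> and \<open>\<tau>\<^sub>i\<^sub>+\<^sub>1\<close> is the last time at which \<open>\<gamma>\<close> is
  in the closed ball of radius \<open>d(z\<^sub>i)/2\<close> around \<open>z\<^sub>i\<close>. Leaving for the last time, rather than the first,
  keeps all later points at distance at least \<open>d(z\<^sub>i)/2\<close> from \<open>z\<^sub>i\<close>, except for an endpoint \<open>\<gamma>(1)\<close>
  that is inside the ball. The construction stops because the sums of the \<open>d(z\<^sub>j)\<close>, which grow at least
  linearly, are bounded by \<open>C\<close> times the supremum of \<open>d\<close> on the curve.
\<close>
lemma diameter_carrot_chain:
  fixes M :: real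
  assumes M: "M \<ge> 1"
  obtains C where "C > 0"
    "\<And>(\<gamma> :: real \<Rightarrow> 'a::euclidean_space) d. \<lbrakk>continuous_on {0..1} \<gamma>; \<And>t. t \<in> {0..1} \<Longrightarrow> d (\<gamma> t) > 0;
        bounded ((\<lambda>t. d (\<gamma> t)) ` {0..1});
        \<And>s t. 0 \<le> s \<Longrightarrow> s \<le> t \<Longrightarrow> t \<le> 1 \<Longrightarrow> dist (\<gamma> s) (\<gamma> t) \<le> M * d (\<gamma> t)\<rbrakk>
     \<Longrightarrow> \<exists>k z. z 0 = \<gamma> 0 \<and> z (Suc k) = \<gamma> 1 \<and>
        (\<forall>i\<le>k. z i \<in> \<gamma> ` {0..1} \<and> dist (z i) (z (Suc i)) \<le> d (z i) / 2 \<and> (\<Sum>j<i. d (z j)) \<le> C * d (z i))"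
proof (rule separated_sequence_sum_bound[OF M, where 'a = 'a])
  fix C :: real
  assume C: "C > 0"
    "\<And>(z :: nat \<Rightarrow> 'a::euclidean_space) d k. \<lbrakk>\<And>i. i \<le> k \<Longrightarrow> d i > 0;
        \<And>i j. j < i \<Longrightarrow> i \<le> k \<Longrightarrow> d j / 2 \<le> dist (z j) (z i);
        \<And>i j. j < i \<Longrightarrow> i \<le> k \<Longrightarrow> dist (z j) (z i) \<le> M * d i\<rbrakk>
       \<Longrightarrow> (\<Sum>j<k. d j) \<le> C * d k"
  show thesis
  proof (rule that[OF C(1)])
    fix \<gamma> :: "real \<Rightarrow> 'a" and d :: "'a \<Rightarrow> real"
    assume cont: "continuous_on {0..1} \<gamma>" and pos: "\<And>t. t \<in> {0..1} \<Longrightarrow> d (\<gamma> t) > 0"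
      and bd: "bounded ((\<lambda>t. d (\<gamma> t)) ` {0..1})"
      and carrot: "\<And>s t. 0 \<le> s \<Longrightarrow> s \<le> t \<Longrightarrow> t \<le> 1 \<Longrightarrow> dist (\<gamma> s) (\<gamma> t) \<le> M * d (\<gamma> t)"
    define P where "P t s \<longleftrightarrow> t \<le> s \<and> s \<le> 1 \<and> dist (\<gamma> t) (\<gamma> s) \<le> d (\<gamma> t) / 2 \<and>
        (s < 1 \<longrightarrow> (\<forall>a\<in>{s..1}. d (\<gamma> t) / 2 \<le> dist (\<gamma> t) (\<gamma> a)))" for t s :: real
    have "\<exists>s. P t s" if "t \<in> {0..1}" for t
    proof -
      have "0 \<le> d (\<gamma> t) / 2" using pos[OF that] by simp
      from last_exit_time[OF cont that this] obtain s where "t \<le> s" "s \<le> 1" "dist (\<gamma> t) (\<gamma> s) \<le> d (\<gamma> t) / 2"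
          "s < 1 \<longrightarrow> (\<forall>a\<in>{s..1}. d (\<gamma> t) / 2 \<le> dist (\<gamma> t) (\<gamma> a))" .
      then show ?thesis unfolding P_def by (intro exI[of _ s]) simp
    qed
    then obtain f where f: "\<And>t. t \<in> {0..1} \<Longrightarrow> P t (f t)" by metis
    define \<tau> where "\<tau> i = (f ^^ i) 0" for i
    have \<tau>0: "\<tau> 0 = 0" by (simp add: \<tau>_def)
    have \<tau>in: "\<tau> i \<in> {0..1}" for i
    proof (induction i)
      case (Suc i)
      then show ?case using f[OF Suc] unfolding P_def by (simp add: \<tau>_def)
    qed (simp add: \<tau>_def)
    have \<tau>P: "P (\<tau> i) (\<tau> (Suc i))" for i using f[OF \<tau>in[of i]] by (simp add: \<tau>_def)
    have \<tau>mono: "\<tau> i \<le> \<tau> j" if "i \<le> j" for i j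
      by (rule lift_Suc_mono_le[OF _ that]) (use \<tau>P in \<open>simp add: P_def\<close>)
    have lo: "d (\<gamma> (\<tau> j)) / 2 \<le> dist (\<gamma> (\<tau> j)) (\<gamma> (\<tau> i))" if "j < i" "\<tau> (Suc j) < 1" for i j
      using \<tau>P[of j] that \<tau>mono[of "Suc j" i] \<tau>in[of i] by (simp add: P_def)
    have sum: "(\<Sum>j<k. d (\<gamma> (\<tau> j))) \<le> C * d (\<gamma> (\<tau> k))" if k: "\<tau> k < 1" for k
    proof (rule C(2)[of k "\<lambda>i. d (\<gamma> (\<tau> i))" "\<lambda>i. \<gamma> (\<tau> i)"])
      show "d (\<gamma> (\<tau> i)) > 0" for i using pos \<tau>in by blast
      fix i j assume "j < i" "i \<le> k"
      then have "\<tau> (Suc j) < 1" using \<tau>mono[of "Suc j" k] k by simp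
      then show "d (\<gamma> (\<tau> j)) / 2 \<le> dist (\<gamma> (\<tau> j)) (\<gamma> (\<tau> i))" using lo \<open>j < i\<close> by blast
      show "dist (\<gamma> (\<tau> j)) (\<gamma> (\<tau> i)) \<le> M * d (\<gamma> (\<tau> i))"
        using carrot \<tau>in[of i] \<tau>in[of j] \<tau>mono[of j i] \<open>j < i\<close> by auto
    qed
    \<comment> \<open>The lower bound \<open>e\<close> for all \<open>d(z\<^sub>j)\<close> holds because \<open>z\<^sub>j\<close> is far from \<open>z\<^sub>0\<close>.\<close>
    have "\<exists>k. \<tau> (Suc k) = 1"
    proof (rule ccontr)
      assume "\<not> ?thesis"
      then have l1: "\<tau> k < 1" for k
      proof -
        have "\<tau> (Suc k) \<noteq> 1" using \<open>\<nexists>k. \<tau> (Suc k) = 1\<close> by blast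
        then show ?thesis using \<tau>in[of "Suc k"] \<tau>mono[of k "Suc k"] by simp
      qed
      obtain D where D: "\<forall>t\<in>{0..1}. \<bar>d (\<gamma> t)\<bar> \<le> D"
        using bd unfolding bounded_iff by auto
      define e where "e = d (\<gamma> 0) / (2 * M)"
      have e: "e > 0" using pos[of 0] M by (simp add: e_def)
      have low: "e \<le> d (\<gamma> (\<tau> j))" if "j > 0" for j
        using lo[OF that l1] carrot[of 0 "\<tau> j"] \<tau>in[of j] M by (simp add: e_def \<tau>0 field_simps)
      have "real k * e \<le> C * D" for k
      proof -
        have "real k * e = (\<Sum>j\<in>{1..<Suc k}. e)" by simp
        also have "\<dots> \<le> (\<Sum>j\<in>{1..<Suc k}. d (\<gamma> (\<tau> j)))" using low by (intro sum_mono) auto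
        also have "\<dots> \<le> (\<Sum>j<Suc k. d (\<gamma> (\<tau> j)))"
          using pos \<tau>in by (intro sum_mono2) (auto intro: less_imp_le)
        also have "\<dots> \<le> C * d (\<gamma> (\<tau> (Suc k)))" by (rule sum[OF l1])
        also have "\<dots> \<le> C * D" using bspec[OF D \<tau>in[of "Suc k"]] C(1) by (intro mult_left_mono) auto
        finally show ?thesis .
      qed
      then show False using reals_Archimedean3[OF e] by (meson not_less)
    qed
    define k where "k = (LEAST k. \<tau> (Suc k) = 1)"
    have k: "\<tau> (Suc k) = 1" unfolding k_def using \<open>\<exists>k. \<tau> (Suc k) = 1\<close> by (rule LeastI_ex)
    have less: "\<tau> i < 1" if "i \<le> k" for i
    proof (cases i)
      case 0 then show ?thesis by (simp add: \<tau>0)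
    next
      case (Suc j)
      then have "\<tau> (Suc j) \<noteq> 1" using not_less_Least[of j "\<lambda>k. \<tau> (Suc k) = 1"] that unfolding k_def by simp
      then show ?thesis using \<tau>in[of i] Suc by simp
    qed
    have "\<gamma> (\<tau> i) \<in> \<gamma> ` {0..1}" for i using \<tau>in by blast
    moreover have "dist (\<gamma> (\<tau> i)) (\<gamma> (\<tau> (Suc i))) \<le> d (\<gamma> (\<tau> i)) / 2" for i
      using \<tau>P[of i] unfolding P_def by blast
    ultimately show "\<exists>k z. z 0 = \<gamma> 0 \<and> z (Suc k) = \<gamma> 1 \<and>
        (\<forall>i\<le>k. z i \<in> \<gamma> ` {0..1} \<and> dist (z i) (z (Suc i)) \<le> d (z i) / 2 \<and> (\<Sum>j<i. d (z j)) \<le> C * d (z i))"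
      using sum less k \<tau>0 by (intro exI[of _ k] exI[of _ "\<lambda>i. \<gamma> (\<tau> i)"]) simp
  qed
qed

lemma curve_length_le_of_1_lipschitz:
  assumes "\<And>x y. a \<le> x \<Longrightarrow> x \<le> y \<Longrightarrow> y \<le> b \<Longrightarrow> dist (\<gamma> x) (\<gamma> y) \<le> y - x"
  shows "curve_length \<gamma> a b \<le> ennreal (b - a)"
  unfolding curve_length_def
proof (rule SUP_least)
  fix Ns :: "nat \<times> (nat \<Rightarrow> real)"
  assume "Ns \<in> {(N, s). s 0 = a \<and> s N = b \<and> mono_on {..N} s}"
  then obtain N s where Ns: "Ns = (N, s)" and s: "mono_on {..N} s" "s 0 = a" "s N = b" by auto
  have r: "s 0 \<le> s i" "s i \<le> s (Suc i)" "s (Suc i) \<le> s N" if "i < N" for i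
    using that by (auto intro!: mono_onD[OF s(1)])
  have "(\<Sum>i<N. ennreal (dist (\<gamma> (s i)) (\<gamma> (s (Suc i))))) = ennreal (\<Sum>i<N. dist (\<gamma> (s i)) (\<gamma> (s (Suc i))))"
    by (intro sum_ennreal) auto
  also have "(\<Sum>i<N. dist (\<gamma> (s i)) (\<gamma> (s (Suc i)))) \<le> (\<Sum>i<N. s (Suc i) - s i)"
    using r assms s by (intro sum_mono) auto
  also have "\<dots> = s N - s 0" by (rule sum_lessThan_telescope)
  finally show "(case Ns of (N, s) \<Rightarrow> \<Sum>i<N. ennreal (dist (\<gamma> (s i)) (\<gamma> (s (Suc i))))) \<le> ennreal (b - a)"
    using Ns s by (simp add: ennreal_leI)
qed

text \<open>
  The polygon through \<open>z\<^sub>0, \<dots>, z\<^sub>k\<close> is run through with unit speed, so it is 1-Lipschitz, which gives the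
  upper bound for its length. For the lower bound, the induction over the edges carries along for each \<open>t\<close>
  an inscribed polygon of length at least \<open>t\<close>, whose nodes are the vertices passed before \<open>t\<close> and the point at
  \<open>t\<close>. The range of \<open>t\<close> in the last clause leaves out 0 since a polygon with \<open>k = 0\<close> has no edge near
  which its point could lie.
\<close>
lemma polygonal_arclength_curve:
  fixes z :: "nat \<Rightarrow> 'a::euclidean_space"
  obtains \<beta> :: "real \<Rightarrow> 'a" and l where "0 \<le> l" "\<beta> 0 = z 0" "\<beta> l = z k"
    "rectifiable_curve \<beta> 0 l" "arclength_parametrized \<beta> l"
    "\<forall>t. 0 < t \<and> t \<le> l \<longrightarrow> (\<exists>i<k. dist (z i) (\<beta> t) \<le> dist (z i) (z (Suc i)) \<and>
                               t \<le> (\<Sum>j\<le>i. dist (z j) (z (Suc j))))"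
proof -
  define len where "len k = (\<Sum>j<k. dist (z j) (z (Suc j)))" for k
  define inscribed where "inscribed \<beta> t \<longleftrightarrow> (\<exists>N s. s 0 = 0 \<and> s N = t \<and> mono_on {..N} s \<and>
       t \<le> (\<Sum>i<N. dist (\<beta> (s i)) (\<beta> (s (Suc i)))))" for \<beta> :: "real \<Rightarrow> 'a" and t :: real
  have len0: "0 \<le> len k" for k by (simp add: len_def sum_nonneg)
  have "\<exists>\<beta>. \<beta> 0 = z 0 \<and> \<beta> (len k) = z k \<and>
      (\<forall>x y. 0 \<le> x \<longrightarrow> x \<le> y \<longrightarrow> y \<le> len k \<longrightarrow> dist (\<beta> x) (\<beta> y) \<le> y - x) \<and>
      (\<forall>t. 0 \<le> t \<longrightarrow> t \<le> len k \<longrightarrow> inscribed \<beta> t) \<and>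
      (\<forall>t. 0 < t \<and> t \<le> len k \<longrightarrow> (\<exists>i<k. dist (z i) (\<beta> t) \<le> dist (z i) (z (Suc i)) \<and> t \<le> len (Suc i)))"
  proof (induction k)
    case 0
    have "inscribed (\<lambda>_. z 0) 0" unfolding inscribed_def
      by (intro exI[of _ 0] exI[of _ "\<lambda>_. 0"]) (simp add: mono_on_def)
    then show ?case by (intro exI[of _ "\<lambda>_. z 0"]) (auto simp: len_def)
  next
    case (Suc k)
    then obtain \<beta> where \<beta>0: "\<beta> 0 = z 0" and \<beta>k: "\<beta> (len k) = z k"
      and lip: "\<And>x y. 0 \<le> x \<Longrightarrow> x \<le> y \<Longrightarrow> y \<le> len k \<Longrightarrow> dist (\<beta> x) (\<beta> y) \<le> y - x"
      and ins: "\<And>t. 0 \<le> t \<Longrightarrow> t \<le> len k \<Longrightarrow> inscribed \<beta> t"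
      and near: "\<And>t. 0 < t \<Longrightarrow> t \<le> len k \<Longrightarrow> \<exists>i<k. dist (z i) (\<beta> t) \<le> dist (z i) (z (Suc i)) \<and> t \<le> len (Suc i)"
      by metis
    define D where "D = dist (z k) (z (Suc k))"
    have lenS: "len (Suc k) = len k + D" by (simp add: len_def D_def)
    \<comment> \<open>For an edge of length 0 this is the vector 0, and the curve is not extended.\<close>
    define e where "e = (z (Suc k) - z k) /\<^sub>R D"
    have e: "norm e = 1" if "D > 0" using that by (simp add: e_def D_def dist_norm norm_minus_commute)
    define \<beta>' where "\<beta>' t = (if t \<le> len k then \<beta> t else z k + (t - len k) *\<^sub>R e)" for t
    have new: "\<beta>' t = z k + (t - len k) *\<^sub>R e" if "len k \<le> t" for t
      using that \<beta>k by (auto simp: \<beta>'_def)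
    have old: "\<beta>' t = \<beta> t" if "t \<le> len k" for t using that by (simp add: \<beta>'_def)
    have dnew: "dist (\<beta>' x) (\<beta>' y) = y - x" if "len k \<le> x" "x \<le> y" "y \<le> len k + D" for x y
    proof (cases "D > 0")
      case True
      have "\<beta>' x - \<beta>' y = (x - y) *\<^sub>R e" using that new[of x] new[of y] by (simp add: scaleR_diff_left)
      then show ?thesis using that e[OF True] by (simp add: dist_norm)
    next
      case False
      then have "x = y" using that by linarith
      then show ?thesis by simp
    qed
    have end': "\<beta>' (len k + D) = z (Suc k)"
      using new[of "len k + D"] by (cases "z k = z (Suc k)") (simp_all add: e_def D_def)
    have "dist (\<beta>' x) (\<beta>' y) \<le> y - x" if "0 \<le> x" "x \<le> y" "y \<le> len k + D" for x y
    proof -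
      consider "y \<le> len k" | "len k \<le> x" | "x \<le> len k" "len k \<le> y" by linarith
      then show ?thesis
      proof cases
        case 1 then show ?thesis using that lip by (simp add: old)
      next
        case 2 then show ?thesis using that dnew by simp
      next
        case 3
        have "dist (\<beta>' x) (\<beta>' y) \<le> dist (\<beta>' x) (\<beta>' (len k)) + dist (\<beta>' (len k)) (\<beta>' y)" by (rule dist_triangle)
        also have "\<dots> \<le> (len k - x) + (y - len k)"
          using 3 that lip dnew[of "len k" y] by (intro add_mono) (auto simp: old)
        finally show ?thesis by simp
      qed
    qed
    moreover have "inscribed \<beta>' t" if t: "0 \<le> t" "t \<le> len k + D" for t
    proof -
      define t' where "t' = min t (len k)"
      have t': "0 \<le> t'" "t' \<le> len k" "t' \<le> t" using t len0 by (auto simp: t'_def)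
      obtain N s where s: "s 0 = 0" "s N = t'" "mono_on {..N} s"
        "t' \<le> (\<Sum>i<N. dist (\<beta> (s i)) (\<beta> (s (Suc i))))"
        using ins[OF t'(1,2)] unfolding inscribed_def by blast
      have sle: "s i \<le> t'" if "i \<le> N" for i using mono_onD[OF s(3), of i N] that s(2) by simp
      define s' where "s' = s(Suc N := t)"
      have "dist (\<beta>' t') (\<beta>' t) = t - t'"
        using t dnew[of "len k" t] by (auto simp: t'_def min_def)
      moreover have "(\<Sum>i<N. dist (\<beta>' (s' i)) (\<beta>' (s' (Suc i)))) = (\<Sum>i<N. dist (\<beta> (s i)) (\<beta> (s (Suc i))))"
        using sle t' by (intro sum.cong) (auto simp: s'_def old order.trans[OF sle])
      ultimately have "t \<le> (\<Sum>i<Suc N. dist (\<beta>' (s' i)) (\<beta>' (s' (Suc i))))"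
        using s by (simp add: s'_def)
      moreover have "mono_on {..Suc N} s'"
      proof (rule mono_onI)
        fix a b assume ab: "a \<in> {..Suc N}" "b \<in> {..Suc N}" "a \<le> b"
        show "s' a \<le> s' b"
        proof (cases "b = Suc N")
          case True
          then show ?thesis using sle[of a] t' ab by (auto simp: s'_def le_Suc_eq)
        next
          case False
          then show ?thesis using ab mono_onD[OF s(3), of a b] by (auto simp: s'_def)
        qed
      qed
      ultimately show ?thesis unfolding inscribed_def using s(1)
        by (intro exI[of _ "Suc N"] exI[of _ s']) (auto simp: s'_def)
    qed
    moreover have "\<exists>i<Suc k. dist (z i) (\<beta>' t) \<le> dist (z i) (z (Suc i)) \<and> t \<le> len (Suc i)"
      if t: "0 < t" "t \<le> len k + D" for t
    proof (cases "t \<le> len k")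
      case True
      then show ?thesis using near[OF t(1)] by (auto simp: old intro: less_SucI)
    next
      case False
      then have "dist (z k) (\<beta>' t) \<le> D" using dnew[of "len k" t] t \<beta>k by (simp add: old)
      then show ?thesis using t by (intro exI[of _ k]) (simp add: D_def[symmetric] lenS)
    qed
    ultimately show ?case
      using end' \<beta>0 len0[of k] by (intro exI[of _ \<beta>']) (simp add: lenS old)
  qed
  then obtain \<beta> where \<beta>: "\<beta> 0 = z 0" "\<beta> (len k) = z k"
      and lip: "\<And>x y. 0 \<le> x \<Longrightarrow> x \<le> y \<Longrightarrow> y \<le> len k \<Longrightarrow> dist (\<beta> x) (\<beta> y) \<le> y - x"
      and ins: "\<And>t. 0 \<le> t \<Longrightarrow> t \<le> len k \<Longrightarrow> inscribed \<beta> t"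
      and near: "\<forall>t. 0 < t \<and> t \<le> len k \<longrightarrow> (\<exists>i<k. dist (z i) (\<beta> t) \<le> dist (z i) (z (Suc i)) \<and> t \<le> len (Suc i))"
    by metis
  have arc: "curve_length \<beta> 0 t = ennreal t" if t: "0 \<le> t" "t \<le> len k" for t
  proof (rule antisym)
    show "curve_length \<beta> 0 t \<le> ennreal t"
      using curve_length_le_of_1_lipschitz[of 0 t \<beta>] lip t by simp
    obtain N s where s: "s 0 = 0" "s N = t" "mono_on {..N} s"
        "t \<le> (\<Sum>i<N. dist (\<beta> (s i)) (\<beta> (s (Suc i))))"
      using ins[OF t] unfolding inscribed_def by blast
    have "ennreal t \<le> ennreal (\<Sum>i<N. dist (\<beta> (s i)) (\<beta> (s (Suc i))))" using s(4) by (rule ennreal_leI)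
    also have "\<dots> = (\<Sum>i<N. ennreal (dist (\<beta> (s i)) (\<beta> (s (Suc i)))))" by (intro sum_ennreal[symmetric]) auto
    also have "\<dots> \<le> curve_length \<beta> 0 t" unfolding curve_length_def using s
      by (intro SUP_upper2[of "(N, s)"]) auto
    finally show "ennreal t \<le> curve_length \<beta> 0 t" .
  qed
  have "continuous_on {0..len k} \<beta>"
  proof (rule continuous_onI)
    fix x \<epsilon> :: real assume x: "x \<in> {0..len k}" and \<epsilon>: "\<epsilon> > 0"
    have "dist (\<beta> x') (\<beta> x) \<le> dist x' x" if "x' \<in> {0..len k}" for x'
      using lip[of x x'] lip[of x' x] x that by (cases "x \<le> x'") (auto simp: dist_real_def dist_commute)
    then show "\<exists>d>0. \<forall>x'\<in>{0..len k}. dist x' x < d \<longrightarrow> dist (\<beta> x') (\<beta> x) \<le> \<epsilon>"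
      using \<epsilon> by (intro exI[of _ \<epsilon>]) force
  qed
  then have "rectifiable_curve \<beta> 0 (len k)"
    unfolding rectifiable_curve_def using arc[of "len k"] len0 by simp
  moreover have "arclength_parametrized \<beta> (len k)"
    unfolding arclength_parametrized_def using arc by simp
  ultimately show thesis
    using \<beta> near len0 by (intro that[of "len k" \<beta>]) (auto simp: len_def lessThan_Suc_atMost)
qed

text \<open>
  Join the points of the chain by segments. The edge starting at \<open>z\<^sub>i\<close> has length at most \<open>d(z\<^sub>i)/2\<close>, so
  \<open>d \<ge> d(z\<^sub>i)/2\<close> on it, while the length of the polygon up to its end is at most
  \<open>\<Sum>\<^sub>j\<^sub>\<le>\<^sub>i d(z\<^sub>j)/2 \<le> (C + 1) d(z\<^sub>i)/2\<close>. Hence \<open>C + 1\<close> is a John constant.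
\<close>
lemma john_domain_of_diameter_carrots:
  fixes G :: "'a::euclidean_space set"
  assumes G: "is_domain G" "G \<noteq> UNIV" "bounded G" and x0: "x0 \<in> G" and M: "M \<ge> 1"
    and carrots: "\<And>x. x \<in> G \<Longrightarrow> \<exists>\<gamma>. path \<gamma> \<and> path_image \<gamma> \<subseteq> G \<and> pathstart \<gamma> = x \<and> pathfinish \<gamma> = x0 \<and>
        (\<forall>s t. 0 \<le> s \<longrightarrow> s \<le> t \<longrightarrow> t \<le> 1 \<longrightarrow> dist (\<gamma> s) (\<gamma> t) \<le> M * bdist G (\<gamma> t))"
  shows "john_domain G"
proof (rule diameter_carrot_chain[OF M, where 'a = 'a])
  fix C :: real
  assume C: "C > 0"
    "\<And>(\<gamma> :: real \<Rightarrow> 'a) d. \<lbrakk>continuous_on {0..1} \<gamma>; \<And>t. t \<in> {0..1} \<Longrightarrow> d (\<gamma> t) > 0;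
        bounded ((\<lambda>t. d (\<gamma> t)) ` {0..1});
        \<And>s t. 0 \<le> s \<Longrightarrow> s \<le> t \<Longrightarrow> t \<le> 1 \<Longrightarrow> dist (\<gamma> s) (\<gamma> t) \<le> M * d (\<gamma> t)\<rbrakk>
     \<Longrightarrow> \<exists>k z. z 0 = \<gamma> 0 \<and> z (Suc k) = \<gamma> 1 \<and>
        (\<forall>i\<le>k. z i \<in> \<gamma> ` {0..1} \<and> dist (z i) (z (Suc i)) \<le> d (z i) / 2 \<and> (\<Sum>j<i. d (z j)) \<le> C * d (z i))"
  have "\<exists>l\<ge>0. \<exists>\<beta>. rectifiable_curve \<beta> 0 l \<and> arclength_parametrized \<beta> l \<and> \<beta> ` {0..l} \<subseteq> G \<and>
        \<beta> 0 = x \<and> \<beta> l = x0 \<and> (\<forall>t\<in>{0..l}. bdist G (\<beta> t) \<ge> t / (C + 1))" if x: "x \<in> G" for x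
  proof -
    obtain \<gamma> where \<gamma>: "path \<gamma>" "path_image \<gamma> \<subseteq> G" "pathstart \<gamma> = x" "pathfinish \<gamma> = x0"
      "\<And>s t. 0 \<le> s \<Longrightarrow> s \<le> t \<Longrightarrow> t \<le> 1 \<Longrightarrow> dist (\<gamma> s) (\<gamma> t) \<le> M * bdist G (\<gamma> t)"
      using carrots[OF x] by blast
    have cont: "continuous_on {0..1} \<gamma>" using \<gamma>(1) by (simp add: path_def)
    have in_G: "\<gamma> t \<in> G" if "t \<in> {0..1}" for t using \<gamma>(2) that by (auto simp: path_image_def)
    have "bounded ((\<lambda>t. bdist G (\<gamma> t)) ` {0..1})" unfolding bdist_def
      by (intro compact_imp_bounded compact_continuous_image continuous_on_infdist cont) simp
    then have "\<exists>k z. z 0 = \<gamma> 0 \<and> z (Suc k) = \<gamma> 1 \<and>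
        (\<forall>i\<le>k. z i \<in> \<gamma> ` {0..1} \<and> dist (z i) (z (Suc i)) \<le> bdist G (z i) / 2 \<and>
          (\<Sum>j<i. bdist G (z j)) \<le> C * bdist G (z i))"
      by (intro C(2)[OF cont _ _ \<gamma>(5)] bdist_pos[OF G(1,2) in_G])
    then obtain k z where z01: "z 0 = \<gamma> 0" "z (Suc k) = \<gamma> 1"
      and zk: "\<forall>i\<le>k. z i \<in> \<gamma> ` {0..1} \<and> dist (z i) (z (Suc i)) \<le> bdist G (z i) / 2 \<and>
          (\<Sum>j<i. bdist G (z j)) \<le> C * bdist G (z i)"
      by (elim exE conjE)
    have z: "z i \<in> \<gamma> ` {0..1}" "dist (z i) (z (Suc i)) \<le> bdist G (z i) / 2"
      "(\<Sum>j<i. bdist G (z j)) \<le> C * bdist G (z i)" if "i \<le> k" for i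
      using zk that by blast+
    obtain \<beta> l where \<beta>: "0 \<le> l" "\<beta> 0 = z 0" "\<beta> l = z (Suc k)"
      "rectifiable_curve \<beta> 0 l" "arclength_parametrized \<beta> l"
      "\<forall>t. 0 < t \<and> t \<le> l \<longrightarrow> (\<exists>i<Suc k. dist (z i) (\<beta> t) \<le> dist (z i) (z (Suc i)) \<and>
                               t \<le> (\<Sum>j\<le>i. dist (z j) (z (Suc j))))"
      by (rule polygonal_arclength_curve)
    have ends: "\<beta> 0 = x" "\<beta> l = x0"
      using \<beta>(2,3) z01 \<gamma>(3,4) by (simp_all add: pathstart_def pathfinish_def)
    have near: "\<beta> t \<in> G \<and> t / (C + 1) \<le> bdist G (\<beta> t)" if t: "0 < t" "t \<le> l" for t
    proof -
      have "\<exists>i<Suc k. dist (z i) (\<beta> t) \<le> dist (z i) (z (Suc i)) \<and>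
                  t \<le> (\<Sum>j\<le>i. dist (z j) (z (Suc j)))"
        using \<beta>(6)[rule_format, OF conjI[OF t]] .
      then obtain i where i: "i \<le> k" "dist (z i) (\<beta> t) \<le> dist (z i) (z (Suc i))"
        "t \<le> (\<Sum>j\<le>i. dist (z j) (z (Suc j)))" unfolding less_Suc_eq_le by (elim exE conjE)
      have ziG: "z i \<in> G" using subsetD[OF \<gamma>(2), of "z i"] z(1)[OF i(1)] by (simp add: path_image_def)
      have pos: "bdist G (z i) > 0" by (rule bdist_pos[OF G(1,2) ziG])
      have half: "dist (z i) (\<beta> t) \<le> bdist G (z i) / 2" using i(2) z(2)[OF i(1)] by linarith
      have "\<beta> t \<in> ball (z i) (bdist G (z i))" using half pos by simp
      then have "\<beta> t \<in> G" using ball_bdist_subset[OF ziG] by blast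
      moreover have "t / (C + 1) \<le> bdist G (\<beta> t)"
      proof -
        have "t \<le> (\<Sum>j\<le>i. bdist G (z j) / 2)"
          by (rule order.trans[OF i(3) sum_mono]) (use z(2) i(1) in auto)
        also have "\<dots> = ((\<Sum>j<i. bdist G (z j)) + bdist G (z i)) / 2"
          by (simp add: sum_divide_distrib[symmetric] lessThan_Suc_atMost[symmetric])
        also have "\<dots> \<le> (C + 1) * (bdist G (z i) / 2)" using z(3)[OF i(1)] by (simp add: algebra_simps)
        finally have "t / (C + 1) \<le> bdist G (z i) / 2" using C(1) by (simp add: pos_divide_le_eq mult.commute)
        also have "\<dots> \<le> bdist G (\<beta> t)" using bdist_triangle[of G "z i" "\<beta> t"] half by linarith
        finally show ?thesis .
      qed
      ultimately show ?thesis ..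
    qed
    have "\<beta> t \<in> G \<and> t / (C + 1) \<le> bdist G (\<beta> t)" if t: "t \<in> {0..l}" for t
    proof (cases "t = 0")
      case True
      then show ?thesis using x ends bdist_pos[OF G(1,2) x] by simp
    next
      case False
      then show ?thesis using near t by simp
    qed
    then show ?thesis using \<beta>(1,4,5) ends by (intro exI[of _ l] conjI exI[of _ \<beta>]) auto
  qed
  then have "c_john_domain (C + 1) G"
    unfolding c_john_domain_def using G C(1) by (intro conjI bexI[OF _ x0] ballI) simp_all
  then show ?thesis unfolding john_domain_def by blast
qed

theorem theorem6p1:
  fixes G :: "'a::euclidean_space set" and x0 :: 'a and \<delta> p :: real
  assumes "DIM('a) \<ge> 2"
    and "is_domain G"
    and "emeasure lebesgue G < \<infinity>"
    and "separation_property G x0"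
    and "0 < \<delta>" and "\<delta> < 1"
    and "1 \<le> p" and "p < real DIM('a) / \<delta>"
    and "\<exists>C1>0. \<forall>u\<in>Linfty G.
           (\<integral>\<^sup>+x. ennreal (\<bar>u x - avg G u\<bar> powr (real DIM('a) * p / (real DIM('a) - \<delta> * p)))
              \<partial>lebesgue_on G)
           \<le> ennreal C1 * ennreal_powr (fractional_energy \<delta> p G u)
                             (real DIM('a) / (real DIM('a) - \<delta> * p))"
  shows "john_domain G"
proof -
  have par: "\<delta> * p < real DIM('a)" using assms(5,8) by (simp add: field_simps)
  obtain C1 where C1: "C1 > 0" "fractional_sobolev_poincare C1 \<delta> p G"
    using assms(9) unfolding fractional_sobolev_poincare_def by blast
  have x0: "x0 \<in> G" and proper: "G \<noteq> UNIV" using assms(4) by (auto simp: separation_property_def)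
  have open_G: "open G" using assms(2) by (simp add: is_domain_def)
  have bdd: "bounded G"
    by (rule bounded_of_fractional_sobolev_poincare[OF assms(5-7) par C1(2,1) open_G assms(3)])
  show ?thesis
    by (rule separation_diameter_carrots[OF assms(5-7) par C1(2,1) assms(3,4)],
        rule john_domain_of_diameter_carrots[OF assms(2) proper bdd x0])
qed

end
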